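(* Let $G$ be a finite simple outerplanar graph of maximum degree $\Delta \geq 5$. Then $\mathrm{ind}(G^2) \leq \Delta + 1$. If moreover $\Delta \geq 7$, then $\mathrm{ind}(G^2) = \Delta$.
   Context: For a graph $G$, the square $G^2$ is the graph on $V(G)$ in which two distinct vertices are adjacent iff their distance in $G$ is 1 or 2. The inductiveness (degeneracy) of a graph $H$ is $\mathrm{ind}(H) = \max\{\delta(H') : H' \text{ an induced subgraph of } H\}$, where $\delta$ denotes minimum degree. *)

theory Defs
  imports "HOL-Analysis.Analysis" "HOL-Library.Extended_Nat"
begin

text \<open>A graph is given by its vertex set \<open>V\<close> and its set \<open>E\<close> of two-element edges.\<close>

definition finite_simple_graph :: "'a set \<Rightarrow> 'a set set \<Rightarrow> bool" where
  "finite_simple_graph V E \<longleftrightarrow> finite V \<and> (\<forall>e\<in>E. e \<subseteq> V \<and> card e = 2)"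

definition vdegree :: "'a set set \<Rightarrow> 'a \<Rightarrow> nat" where
  "vdegree E v = card {e \<in> E. v \<in> e}"

text \<open>The inserted 0 only matters for the graph without vertices, whose maximum degree is
  thereby 0 instead of an unspecified number.\<close>

definition max_degree :: "'a set \<Rightarrow> 'a set set \<Rightarrow> nat" where
  "max_degree V E = Max (insert 0 (vdegree E ` V))"

definition min_degree :: "'a set \<Rightarrow> 'a set set \<Rightarrow> nat" where
  "min_degree V E = Min (vdegree E ` V)"

definition walk_betw :: "'a set \<Rightarrow> 'a set set \<Rightarrow> 'a \<Rightarrow> 'a list \<Rightarrow> 'a \<Rightarrow> bool" where
  "walk_betw V E u xs v \<longleftrightarrow> xs \<noteq> [] \<and> set xs \<subseteq> V \<and> hd xs = u \<and> last xs = v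
     \<and> successively (\<lambda>x y. {x, y} \<in> E) xs"

text \<open>The distance is \<open>\<infinity>\<close> between vertices of different components.\<close>

definition gdist :: "'a set \<Rightarrow> 'a set set \<Rightarrow> 'a \<Rightarrow> 'a \<Rightarrow> enat" where
  "gdist V E u v = (INF xs \<in> {xs. walk_betw V E u xs v}. enat (length xs - 1))"

definition square_edges :: "'a set \<Rightarrow> 'a set set \<Rightarrow> 'a set set" where
  "square_edges V E =
     {{u, v} | u v. u \<in> V \<and> v \<in> V \<and> u \<noteq> v \<and> (gdist V E u v = 1 \<or> gdist V E u v = 2)}"

definition induced_edges :: "'a set set \<Rightarrow> 'a set \<Rightarrow> 'a set set" where
  "induced_edges E S = {e \<in> E. e \<subseteq> S}"

definition inductiveness :: "'a set \<Rightarrow> 'a set set \<Rightarrow> nat" where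
  "inductiveness V E = Max {min_degree S (induced_edges E S) | S. S \<subseteq> V \<and> S \<noteq> {}}"

text \<open>A plane embedding places the vertices by \<open>p\<close> and draws each edge \<open>e\<close> as the Jordan
  arc \<open>c e\<close>.\<close>

definition plane_embedding ::
    "'a set \<Rightarrow> 'a set set \<Rightarrow> ('a \<Rightarrow> complex) \<Rightarrow> ('a set \<Rightarrow> real \<Rightarrow> complex) \<Rightarrow> bool" where
  "plane_embedding V E p c \<longleftrightarrow>
     inj_on p V
     \<and> (\<forall>e\<in>E. arc (c e) \<and> {pathstart (c e), pathfinish (c e)} = p ` e
              \<and> path_image (c e) \<inter> p ` V = p ` e)
     \<and> (\<forall>e\<in>E. \<forall>f\<in>E. e \<noteq> f \<longrightarrow> path_image (c e) \<inter> path_image (c f) \<subseteq> p ` (e \<inter> f))"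

definition drawing ::
    "'a set \<Rightarrow> 'a set set \<Rightarrow> ('a \<Rightarrow> complex) \<Rightarrow> ('a set \<Rightarrow> real \<Rightarrow> complex) \<Rightarrow> complex set" where
  "drawing V E p c = p ` V \<union> (\<Union>e\<in>E. path_image (c e))"

text \<open>The drawing of a finite graph is compact, so \<^const>\<open>outside\<close> of it is its unique
  unbounded face.\<close>

definition outerplanar :: "'a set \<Rightarrow> 'a set set \<Rightarrow> bool" where
  "outerplanar V E \<longleftrightarrow>
     (\<exists>p c. plane_embedding V E p c \<and> p ` V \<subseteq> frontier (outside (drawing V E p c)))"

end

theory Submission
  imports Defs
begin

text \<open>In a drawing with all vertices on the outer face no vertex lies inside a cycle.  Together with
  the Jordan curve theorem this excludes three internally disjoint paths with inner vertices between
  two vertices, and cycles with two crossing chords.  The latter forces a vertex of degree at most 2;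
  deleting it and joining its neighbours keeps the graph outerplanar, and by induction the vertices
  can be arranged on a circle so that no two edges cross.

  On a circle, an arc of positions that edges leave only through its two ends splits into two such
  arcs.  Combining small arcs one finds that an arc spanning more than five steps always contains a
  vertex of degree at most 2 with at most \<open>k\<close> vertices at distance 1 or 2, where \<open>k = \<Delta>\<close> if
  \<open>\<Delta> \<ge> 7\<close> and \<open>k = \<Delta> + 1\<close> if \<open>\<Delta> \<in> {5, 6}\<close>.  If such a vertex lies in the set inducing the subgraph of
  the square, its degree there is at most \<open>k\<close>; otherwise deleting it and joining its neighbours does not
  increase degrees and destroys no adjacency of the square between other vertices.  The lower bound is
  witnessed by the closed neighbourhood of a vertex of maximum degree, a clique of the square.\<close>

subsection \<open>Theta curves\<close>

text \<open>An induced subgraph of the square need not be the square of a subgraph: a vertex outside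
  the chosen set may be the midpoint of many pairs inside it. So the induction runs over the ambient
  graph with the set fixed, and a removed vertex needs degree at most 2 as well as few vertices
  within distance 2. Since removals may lower the maximum degree, a degree bound \<open>D\<close> is
  carried along in place of \<Delta>. Topology serves only to obtain the circular order; all
  counting is done on positions. The finite search must not depend on \<Delta>. Beyond an end of an
  arc nothing is known, except that the end has at most \<open>D\<close> neighbours in all. Hence an
  inner vertex adjacent to one end is judged relative to \<open>D\<close>, and one adjacent to no
  end by an absolute bound. This gives two parameters with \<open>s \<le> k\<close> and
  \<open>D + t \<le> k\<close>: the pair \<open>(7, 0)\<close> serves every \<Delta> \<ge> 7 with
  \<open>k\<close> = \<Delta>, and \<open>(6, 1)\<close> serves \<Delta> = 5 with
  \<open>k = 6\<close>.\<close>

lemma Jordan_arcs: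
  fixes c1 c2 :: "real \<Rightarrow> complex"
  assumes "arc c1" "arc c2" "pathstart c1 = a" "pathfinish c1 = b"
    "pathstart c2 = a" "pathfinish c2 = b" "path_image c1 \<inter> path_image c2 = {a, b}"
  defines "C \<equiv> path_image c1 \<union> path_image c2"
  shows "inside C \<noteq> {}" "connected (inside C)" "connected (outside C)"
    "inside C \<union> outside C = - C" "frontier (inside C) = C" "compact C"
proof -
  have sp: "simple_path (c1 +++ reversepath c2)"
    using assms by (intro simple_path_join_loop) (auto simp: arc_reversepath)
  have im: "path_image (c1 +++ reversepath c2) = C"
    using assms by (simp add: path_image_join)
  have "pathfinish (c1 +++ reversepath c2) = pathstart (c1 +++ reversepath c2)"
    using assms by simp
  from Jordan_inside_outside[OF sp this]
  show "inside C \<noteq> {}" "connected (inside C)" "connected (outside C)"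
    "inside C \<union> outside C = - C" "frontier (inside C) = C" by (simp_all add: im)
  show "compact C" using sp im compact_simple_path_image by metis
qed

lemma connected_subset_inside:
  fixes K X :: "complex set"
  assumes "closed K" "connected X" "X \<inter> K = {}" "X \<inter> inside K \<noteq> {}"
  shows "X \<subseteq> inside K"
proof -
  have "X \<subseteq> inside K \<union> outside K" using assms(3) inside_Un_outside[of K] by blast
  moreover have "inside K \<inter> outside K \<inter> X = {}" using inside_Int_outside[of K] by blast
  ultimately have "outside K \<inter> X = {}"
    using connectedD[OF assms(2) open_inside[OF assms(1)] open_outside[OF assms(1)]] assms(4) by blast
  with \<open>X \<subseteq> inside K \<union> outside K\<close> show ?thesis by blast
qed

text \<open>Each inside is connected and misses the other curve, so it lies wholly on one side of
  it; a common point selects the inner side.\<close>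

lemma inside_eqI:
  fixes K L :: "complex set"
  assumes "inside K \<inter> inside L \<noteq> {}" "inside K \<inter> L = {}" "inside L \<inter> K = {}"
    and "closed K" "closed L" "connected (inside K)" "connected (inside L)"
  shows "inside K = inside L"
  using connected_subset_inside[OF assms(4,7,3)] connected_subset_inside[OF assms(5,6,2)] assms(1)
  by blast

lemma arc_not_subset_endpoints:
  assumes "arc c"
  shows "\<not> path_image c \<subseteq> {pathstart c, pathfinish c}"
proof -
  have "c (1/2) \<noteq> c 0" "c (1/2) \<noteq> c 1"
    using arcD[OF assms, of "1/2" 0] arcD[OF assms, of "1/2" 1] by auto
  moreover have "c (1/2) \<in> path_image c" by (simp add: path_image_def)
  ultimately show ?thesis by (auto simp: pathstart_def pathfinish_def)
qed

text \<open>Suppose \<open>c3\<close> stayed out as well. Then the inside of the cycle of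
  \<open>c1\<close> and \<open>c2\<close> is disjoint from the insides of the other two cycles, so a
  point of it can be joined to a far point off either of them. These two cycles share just the
  connected set \<open>path_image c3\<close>, so by Janiszewski's theorem both points can be joined
  off their union, which covers the first cycle.\<close>

lemma theta_curve_some_arc_inside:
  fixes c1 c2 c3 :: "real \<Rightarrow> complex"
  assumes arcs: "arc c1" "arc c2" "arc c3"
    and ends: "pathstart c1 = a" "pathfinish c1 = b" "pathstart c2 = a" "pathfinish c2 = b"
      "pathstart c3 = a" "pathfinish c3 = b"
    and int: "path_image c1 \<inter> path_image c2 = {a, b}" "path_image c1 \<inter> path_image c3 = {a, b}"
      "path_image c2 \<inter> path_image c3 = {a, b}"
    and out1: "path_image c1 \<inter> inside (path_image c2 \<union> path_image c3) = {}"
    and out2: "path_image c2 \<inter> inside (path_image c1 \<union> path_image c3) = {}"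
  shows "path_image c3 \<inter> inside (path_image c1 \<union> path_image c2) \<noteq> {}"
proof
  assume out3: "path_image c3 \<inter> inside (path_image c1 \<union> path_image c2) = {}"
  let ?C12 = "path_image c1 \<union> path_image c2"
  let ?C13 = "path_image c1 \<union> path_image c3"
  let ?C23 = "path_image c2 \<union> path_image c3"
  note J12 = Jordan_arcs[OF arcs(1,2) ends(1-4) int(1)]
  note J13 = Jordan_arcs[OF arcs(1,3) ends(1,2,5,6) int(2)]
  note J23 = Jordan_arcs[OF arcs(2,3) ends(3-6) int(3)]
  have ne: "\<not> path_image c1 \<subseteq> {a, b}" "\<not> path_image c2 \<subseteq> {a, b}"
    using arc_not_subset_endpoints arcs ends by metis+
  have d1: "inside ?C12 \<inter> inside ?C13 = {}"
  proof (rule ccontr)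
    assume "inside ?C12 \<inter> inside ?C13 \<noteq> {}"
    moreover have "inside ?C12 \<inter> ?C13 = {}" "inside ?C13 \<inter> ?C12 = {}"
      using out2 out3 inside_no_overlap[of ?C12] inside_no_overlap[of ?C13] by blast+
    ultimately have "inside ?C12 = inside ?C13"
      by (intro inside_eqI compact_imp_closed J12(2,6) J13(2,6))
    \<comment> \<open>Equal insides have equal frontiers, and these are the curves
      themselves.\<close>
    from arg_cong[OF this, of frontier] have "?C12 = ?C13" unfolding J12(5) J13(5) .
    then show False using int ne(2) by blast
  qed
  have d2: "inside ?C12 \<inter> inside ?C23 = {}"
  proof (rule ccontr)
    assume "inside ?C12 \<inter> inside ?C23 \<noteq> {}"
    moreover have "inside ?C12 \<inter> ?C23 = {}" "inside ?C23 \<inter> ?C12 = {}"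
      using out1 out3 inside_no_overlap[of ?C12] inside_no_overlap[of ?C23] by blast+
    ultimately have "inside ?C12 = inside ?C23"
      by (intro inside_eqI compact_imp_closed J12(2,6) J23(2,6))
    from arg_cong[OF this, of frontier] have "?C12 = ?C23" unfolding J12(5) J23(5) .
    then show False using int ne(1) by blast
  qed
  obtain x where x: "x \<in> inside ?C12" using J12(1) by blast
  have "outside (?C13 \<union> ?C23) \<noteq> {}"
    by (intro outside_bounded_nonempty compact_imp_bounded compact_Un J13(6) J23(6))
  then obtain y where y: "y \<in> outside (?C13 \<union> ?C23)" by blast
  have yy: "y \<in> outside ?C12" "y \<in> outside ?C13" "y \<in> outside ?C23"
    using y outside_mono[of ?C12 "?C13 \<union> ?C23"] outside_mono[of ?C13 "?C13 \<union> ?C23"]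
      outside_mono[of ?C23 "?C13 \<union> ?C23"] by blast+
  have "x \<notin> ?C13 \<union> ?C23" using x out3 inside_no_overlap[of ?C12] by blast
  then have "x \<in> outside ?C13" "x \<in> outside ?C23" using x d1 d2 J13(4) J23(4) by blast+
  moreover have "connected_component (- K) x y"
    if "x \<in> outside K" "connected (outside K)" "y \<in> outside K" for K
    unfolding connected_component_def using that outside_no_overlap[of K] by blast
  ultimately have cc: "connected_component (- ?C13) x y" "connected_component (- ?C23) x y"
    using yy J13(3) J23(3) by blast+
  have "?C13 \<inter> ?C23 = path_image c3" using int pathstart_in_path_image[of c3]
      pathfinish_in_path_image[of c3] ends by blast
  then have "connected (?C13 \<inter> ?C23)"
    using arcs by (simp add: arc_imp_path connected_path_image)
  from Janiszewski[OF J13(6) compact_imp_closed[OF J23(6)] this cc]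
  have "connected_component (- ?C12) x y"
    by (rule connected_component_of_subset) auto
  then show False
    using x yy(1) by (meson disjoint_iff inside_Int_outside inside_same_component)
qed

subsection \<open>Paths in a drawing\<close>

fun path_edges :: "'a list \<Rightarrow> 'a set set" where
  "path_edges (x # y # zs) = insert {x, y} (path_edges (y # zs))"
| "path_edges _ = {}"

definition simple_walk :: "'a set set \<Rightarrow> 'a list \<Rightarrow> bool" where
  "simple_walk E xs \<longleftrightarrow> distinct xs \<and> path_edges xs \<subseteq> E"

lemma path_edges_subset: "e \<in> path_edges xs \<Longrightarrow> e \<subseteq> set xs"
  by (induction xs rule: path_edges.induct) auto

lemma path_edges_append:
  "xs \<noteq> [] \<Longrightarrow> ys \<noteq> [] \<Longrightarrow>
    path_edges (xs @ ys) = path_edges xs \<union> path_edges ys \<union> {{last xs, hd ys}}"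
proof (induction xs rule: path_edges.induct)
  case (1 x y zs)
  then show ?case by auto
next
  case ("2_2" v)
  then show ?case by (cases ys) auto
qed auto

lemma path_edges_rev: "path_edges (rev xs) = path_edges xs"
proof (induction xs rule: path_edges.induct)
  case (1 x y zs)
  then show ?case
    using path_edges_append[of "rev (y # zs)" "[x]"] by (auto simp: insert_commute)
qed auto

lemma simple_walk_rev: "simple_walk E (rev xs) = simple_walk E xs"
  by (simp add: simple_walk_def path_edges_rev)

lemma ends_not_path_edge:
  assumes "distinct (a # xs @ [b])" "xs \<noteq> []"
  shows "{a, b} \<notin> path_edges (a # xs @ [b])"
proof -
  have "path_edges (a # xs @ [b]) = path_edges (xs @ [b]) \<union> {{a, hd xs}}"
    using assms path_edges_append[of "[a]" "xs @ [b]"] by auto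
  moreover have "{a, b} \<notin> path_edges (xs @ [b])"
    using path_edges_subset[of "{a, b}" "xs @ [b]"] assms by auto
  moreover have "{a, b} \<noteq> {a, hd xs}" using assms by (cases xs) (auto simp: doubleton_eq_iff)
  ultimately show ?thesis by simp
qed

definition edge_image :: "('a set \<Rightarrow> real \<Rightarrow> complex) \<Rightarrow> 'a list \<Rightarrow> complex set" where
  "edge_image c xs = (\<Union>e\<in>path_edges xs. path_image (c e))"

locale outerplane_graph =
  fixes V :: "'a set" and E :: "'a set set"
    and p :: "'a \<Rightarrow> complex" and c :: "'a set \<Rightarrow> real \<Rightarrow> complex"
  assumes graph: "finite_simple_graph V E"
    and embedding: "plane_embedding V E p c"
    and outer: "p ` V \<subseteq> frontier (outside (drawing V E p c))"
begin

lemma edge_subset: "e \<in> E \<Longrightarrow> e \<subseteq> V" and edge_card: "e \<in> E \<Longrightarrow> card e = 2"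
  using graph by (auto simp: finite_simple_graph_def)

lemma edge_neq: "{x, y} \<in> E \<Longrightarrow> x \<noteq> y"
  using edge_card by fastforce

lemma inj_p: "inj_on p V" and edge_arc: "e \<in> E \<Longrightarrow> arc (c e)"
  and edge_ends: "e \<in> E \<Longrightarrow> {pathstart (c e), pathfinish (c e)} = p ` e"
  and edge_meets_vertices: "e \<in> E \<Longrightarrow> path_image (c e) \<inter> p ` V = p ` e"
  and edges_meet: "e \<in> E \<Longrightarrow> f \<in> E \<Longrightarrow> e \<noteq> f \<Longrightarrow>
    path_image (c e) \<inter> path_image (c f) \<subseteq> p ` (e \<inter> f)"
  using embedding by (auto simp: plane_embedding_def)

lemma finite_E: "finite E"
  using graph finite_subset[of E "Pow V"] by (auto simp: finite_simple_graph_def)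

text \<open>The vertex is a limit of points of the unbounded face. If the open set
  \<open>inside K\<close> contained it, it would contain such points too, but they lie outside the
  drawing and hence outside the smaller set \<open>K\<close>.\<close>

lemma vertex_not_inside:
  assumes "closed K" "K \<subseteq> drawing V E p c" "v \<in> V"
  shows "p v \<notin> inside K"
proof
  assume v: "p v \<in> inside K"
  have "p v \<in> closure (outside (drawing V E p c))"
    using outer assms(3) by (auto simp: frontier_def)
  then obtain y where "y \<in> inside K" "y \<in> outside (drawing V E p c)"
    using v open_inside[OF assms(1)] by (meson closure_iff_nhds_not_empty order_refl disjoint_iff)
  then show False using outside_mono[OF assms(2)] inside_Int_outside[of K] by blast
qed

lemma edge_arc_from:
  assumes "{x, y} \<in> E"
  shows "\<exists>g. arc g \<and> pathstart g = p x \<and> pathfinish g = p y \<and> path_image g = path_image (c {x, y})"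
proof -
  have "{pathstart (c {x, y}), pathfinish (c {x, y})} = {p x, p y}"
    using edge_ends[OF assms] by simp
  then consider "pathstart (c {x, y}) = p x" "pathfinish (c {x, y}) = p y"
    | "pathstart (c {x, y}) = p y" "pathfinish (c {x, y}) = p x"
    by (auto simp: doubleton_eq_iff)
  then show ?thesis
  proof cases
    case 1
    then show ?thesis using edge_arc[OF assms] by blast
  next
    case 2
    then show ?thesis using edge_arc[OF assms]
      by (intro exI[of _ "reversepath (c {x, y})"]) (simp add: arc_reversepath)
  qed
qed

lemma edge_image_meets:
  assumes "path_edges xs \<subseteq> E" "path_edges ys \<subseteq> E" "path_edges xs \<inter> path_edges ys = {}"
  shows "edge_image c xs \<inter> edge_image c ys \<subseteq> p ` (set xs \<inter> set ys)"
proof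
  fix z assume "z \<in> edge_image c xs \<inter> edge_image c ys"
  then obtain e f where ef: "e \<in> path_edges xs" "f \<in> path_edges ys"
    "z \<in> path_image (c e)" "z \<in> path_image (c f)" by (auto simp: edge_image_def)
  then have "z \<in> p ` (e \<inter> f)" using edges_meet[of e f] assms by blast
  then show "z \<in> p ` (set xs \<inter> set ys)" using ef path_edges_subset by blast
qed

lemma edge_image_vertices:
  assumes "path_edges xs \<subseteq> E"
  shows "edge_image c xs \<inter> p ` V \<subseteq> p ` set xs"
  using assms edge_meets_vertices path_edges_subset by (fastforce simp: edge_image_def)

lemma edge_image_drawing: "path_edges xs \<subseteq> E \<Longrightarrow> edge_image c xs \<subseteq> drawing V E p c"
  by (auto simp: edge_image_def drawing_def)

lemma vertex_in_edge_image:
  "path_edges xs \<subseteq> E \<Longrightarrow> x \<in> set xs \<Longrightarrow> length xs \<ge> 2 \<Longrightarrow> p x \<in> edge_image c xs"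
proof (induction xs rule: path_edges.induct)
  case (1 a b zs)
  have ab: "p a \<in> path_image (c {a, b})" "p b \<in> path_image (c {a, b})"
    using 1(2) edge_meets_vertices[of "{a, b}"] by auto
  show ?case
  proof (cases "x = a \<or> x = b")
    case True
    then show ?thesis using ab by (auto simp: edge_image_def)
  next
    case False
    then have "length (b # zs) \<ge> 2" using 1(3) by (cases zs) auto
    then show ?thesis using 1 False by (auto simp: edge_image_def)
  qed
qed auto

lemma simple_walk_arc:
  assumes "simple_walk E xs" "length xs \<ge> 2"
  shows "\<exists>g. arc g \<and> pathstart g = p (hd xs) \<and> pathfinish g = p (last xs) \<and>
    path_image g = edge_image c xs"
  using assms
proof (induction xs rule: path_edges.induct)
  case (1 x y zs)
  have xy: "{x, y} \<in> E" using 1(2) by (simp add: simple_walk_def)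
  from edge_arc_from[OF xy] obtain g where g: "arc g" "pathstart g = p x" "pathfinish g = p y"
    "path_image g = path_image (c {x, y})" by blast
  show ?case
  proof (cases zs)
    case Nil
    then show ?thesis using g by (auto simp: edge_image_def)
  next
    case (Cons z zs')
    have sw: "simple_walk E (y # zs)" using 1(2) by (simp add: simple_walk_def)
    with 1(1) Cons obtain h where h: "arc h" "pathstart h = p y"
      "pathfinish h = p (last (y # zs))" "path_image h = edge_image c (y # zs)" by auto
    have "path_edges [x, y] \<inter> path_edges (y # zs) = {}"
      using 1(2) path_edges_subset[of _ "y # zs"] by (fastforce simp: simple_walk_def)
    then have "edge_image c [x, y] \<inter> edge_image c (y # zs) \<subseteq> p ` (set [x, y] \<inter> set (y # zs))"
      using sw xy by (intro edge_image_meets) (auto simp: simple_walk_def)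
    also have "set [x, y] \<inter> set (y # zs) = {y}" using 1(2) by (auto simp: simple_walk_def)
    finally have "path_image g \<inter> path_image h \<subseteq> {pathstart h}"
      using g h by (simp add: edge_image_def)
    then have "arc (g +++ h)" using g h by (simp add: arc_join)
    moreover have "path_image (g +++ h) = edge_image c (x # y # zs)"
      using g h by (simp add: path_image_join edge_image_def)
    ultimately show ?thesis using g h by (intro exI[of _ "g +++ h"]) simp
  qed
qed auto

end

subsection \<open>Excluded subgraphs\<close>

lemma arc_subset_closure_endless:
  assumes "arc g"
  shows "path_image g \<subseteq> closure (path_image g - {pathstart g, pathfinish g})"
proof -
  have "continuous_on (closure {0<..<1}) g"
    using arc_imp_path[OF assms] by (simp add: path_def)
  then have "g ` closure {0<..<1} \<subseteq> closure (g ` {0<..<1})"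
    by (intro image_closure_subset) (auto intro: closure_subset[THEN subsetD])
  then show ?thesis
    using simple_path_endless[OF arc_imp_simple_path[OF assms]] by (simp add: path_image_def)
qed

context outerplane_graph
begin

lemma walk_subset_V:
  assumes "path_edges xs \<subseteq> E" "length xs \<ge> 2"
  shows "set xs \<subseteq> V"
  using assms
proof (induction xs rule: path_edges.induct)
  case (1 x y zs)
  have "{x, y} \<subseteq> V" using 1(2) edge_subset[of "{x, y}"] by auto
  then show ?case using 1 by (cases zs) auto
qed auto

lemma closed_edge_image:
  assumes "path_edges xs \<subseteq> E"
  shows "closed (edge_image c xs)"
proof -
  have "finite (path_edges xs)" using assms finite_E by (rule finite_subset)
  moreover have "closed (path_image (c e))" if "e \<in> path_edges xs" for e
    using that assms edge_arc arc_imp_path closed_path_image by (metis subsetD)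
  ultimately show ?thesis unfolding edge_image_def by (intro closed_UN) auto
qed

text \<open>A common edge could only be \<open>{a, b}\<close>, which a path with an inner vertex
  does not use. \<open>ys\<close> may be empty, so that chords are covered.\<close>

lemma two_paths_meet:
  assumes "simple_walk E (a # xs @ [b])" "simple_walk E (a # ys @ [b])"
    and "set xs \<inter> set ys = {}" "xs \<noteq> []"
  shows "edge_image c (a # xs @ [b]) \<inter> edge_image c (a # ys @ [b]) = {p a, p b}"
proof -
  let ?P = "a # xs @ [b]" and ?Q = "a # ys @ [b]"
  have E: "path_edges ?P \<subseteq> E" "path_edges ?Q \<subseteq> E"
    and ab: "set ?P \<inter> set ?Q = {a, b}"
    using assms by (auto simp: simple_walk_def)
  have "e = {a, b}" if "e \<in> path_edges ?P" "e \<in> path_edges ?Q" for e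
  proof (rule card_subset_eq)
    show "e \<subseteq> {a, b}"
      using path_edges_subset[OF that(1)] path_edges_subset[OF that(2)] ab by blast
    show "card e = card {a, b}" using that E edge_card assms by (auto simp: simple_walk_def)
  qed simp
  then have "path_edges ?P \<inter> path_edges ?Q = {}"
    using ends_not_path_edge[of a xs b] assms by (auto simp: simple_walk_def)
  from edge_image_meets[OF E this]
  have "edge_image c ?P \<inter> edge_image c ?Q \<subseteq> {p a, p b}" unfolding ab by simp
  moreover have "p z \<in> edge_image c ?P \<inter> edge_image c ?Q" if "z \<in> {a, b}" for z
    using vertex_in_edge_image[OF E(1), of z] vertex_in_edge_image[OF E(2), of z] that by auto
  ultimately show ?thesis by blast
qed

text \<open>Without its ends the path is connected and misses \<open>K\<close>, so on entering the
  inside it would stay there together with an inner vertex.\<close>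

lemma path_not_inside:
  assumes P: "simple_walk E (a # xs @ [b])" "xs \<noteq> []"
    and K: "closed K" "K \<subseteq> drawing V E p c" "edge_image c (a # xs @ [b]) \<inter> K \<subseteq> {p a, p b}"
      "p a \<in> K" "p b \<in> K"
  shows "edge_image c (a # xs @ [b]) \<inter> inside K = {}"
proof (rule ccontr)
  let ?P = "a # xs @ [b]"
  assume "edge_image c ?P \<inter> inside K \<noteq> {}"
  obtain g where g: "arc g" "pathstart g = p a" "pathfinish g = p b" "path_image g = edge_image c ?P"
    using simple_walk_arc[OF P(1)] by auto
  let ?X = "edge_image c ?P - {p a, p b}"
  have "connected ?X" using connected_simple_path_endless[OF arc_imp_simple_path[OF g(1)]] g by simp
  moreover have "?X \<inter> K = {}" using K by blast
  moreover have "?X \<inter> inside K \<noteq> {}"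
    using \<open>edge_image c ?P \<inter> inside K \<noteq> {}\<close> K inside_no_overlap[of K] by blast
  ultimately have sub: "?X \<subseteq> inside K" using K(1) by (intro connected_subset_inside) auto
  have V: "set ?P \<subseteq> V" using P by (intro walk_subset_V) (auto simp: simple_walk_def)
  obtain x where x: "x \<in> set xs" using P(2) by (meson list.set_sel(1))
  have "p x \<in> edge_image c ?P" using P x by (intro vertex_in_edge_image) (auto simp: simple_walk_def)
  moreover have "p x \<noteq> p a" "p x \<noteq> p b"
    using inj_onD[OF inj_p, of x a] inj_onD[OF inj_p, of x b] V x P by (auto simp: simple_walk_def)
  ultimately have "p x \<in> inside K" using sub by blast
  then show False using vertex_not_inside[OF K(1,2), of x] V x by auto
qed

text \<open>The first two paths have inner vertices and so cannot run inside; the theta curve leaves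
  this to the third. As \<open>zs\<close> may be empty, this also locates chords of a cycle.\<close>

lemma third_path_inside:
  assumes P: "simple_walk E (a # xs @ [b])" "simple_walk E (a # ys @ [b])" "simple_walk E (a # zs @ [b])"
    and ne: "xs \<noteq> []" "ys \<noteq> []"
    and disj: "set xs \<inter> set ys = {}" "set xs \<inter> set zs = {}" "set ys \<inter> set zs = {}"
  shows "edge_image c (a # zs @ [b]) \<inter>
    inside (edge_image c (a # xs @ [b]) \<union> edge_image c (a # ys @ [b])) \<noteq> {}"
proof -
  let ?P = "a # xs @ [b]" and ?Q = "a # ys @ [b]" and ?R = "a # zs @ [b]"
  note E = P[unfolded simple_walk_def, THEN conjunct2]
  obtain g where g: "arc g" "pathstart g = p a" "pathfinish g = p b" "path_image g = edge_image c ?P"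
    using simple_walk_arc[OF P(1)] by auto
  obtain h where h: "arc h" "pathstart h = p a" "pathfinish h = p b" "path_image h = edge_image c ?Q"
    using simple_walk_arc[OF P(2)] by auto
  obtain k where k: "arc k" "pathstart k = p a" "pathfinish k = p b" "path_image k = edge_image c ?R"
    using simple_walk_arc[OF P(3)] by auto
  note m = two_paths_meet[OF P(1,2) disj(1) ne(1)] two_paths_meet[OF P(1,3) disj(2) ne(1)]
    two_paths_meet[OF P(2,3) disj(3) ne(2)]
  have "edge_image c ?P \<inter> inside (edge_image c ?Q \<union> edge_image c ?R) = {}"
    using m by (intro path_not_inside P ne closed_Un closed_edge_image E Un_least edge_image_drawing) auto
  moreover have "edge_image c ?Q \<inter> inside (edge_image c ?P \<union> edge_image c ?R) = {}"
    using m by (intro path_not_inside P ne closed_Un closed_edge_image E Un_least edge_image_drawing) auto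
  ultimately show ?thesis
    by (rule theta_curve_some_arc_inside[OF g(1) h(1) k(1) g(2,3) h(2,3) k(2,3),
          unfolded g(4) h(4) k(4), OF m])
qed

text \<open>The third path is forced inside the cycle of the other two, yet its inner vertex must
  stay out. The configuration is a subdivision of the complete bipartite graph on 2 + 3
  vertices.\<close>

lemma no_theta_subgraph:
  assumes P: "simple_walk E (a # xs @ [b])" "simple_walk E (a # ys @ [b])" "simple_walk E (a # zs @ [b])"
    and ne: "xs \<noteq> []" "ys \<noteq> []" "zs \<noteq> []"
    and disj: "set xs \<inter> set ys = {}" "set xs \<inter> set zs = {}" "set ys \<inter> set zs = {}"
  shows False
proof -
  note E = P[unfolded simple_walk_def, THEN conjunct2]
  note m = two_paths_meet[OF P(1,2) disj(1) ne(1)] two_paths_meet[OF P(1,3) disj(2) ne(1)]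
    two_paths_meet[OF P(2,3) disj(3) ne(2)]
  have "edge_image c (a # zs @ [b]) \<inter>
      inside (edge_image c (a # xs @ [b]) \<union> edge_image c (a # ys @ [b])) = {}"
    using m by (intro path_not_inside P ne closed_Un closed_edge_image E Un_least edge_image_drawing) auto
  then show False using third_path_inside[OF P ne(1,2) disj] by simp
qed

text \<open>Both chords run inside the cycle, and \<open>{a, b}\<close> cuts the inside into two
  regions. The other chord stays in one of them; its end on the far side of the cycle would be in
  the closure of that region but not on its boundary, hence inside a cycle. The configuration is a
  subdivision of the complete graph on 4 vertices with two opposite edges left undivided.\<close>

lemma no_crossing_chords:
  assumes P: "simple_walk E (a # xs @ [b])" "simple_walk E (a # ys @ [b])"
    and disj: "set xs \<inter> set ys = {}" and xy: "x \<in> set xs" "y \<in> set ys"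
    and chords: "{a, b} \<in> E" "{x, y} \<in> E"
  shows False
proof -
  let ?P = "a # xs @ [b]" and ?Q = "a # ys @ [b]"
  have ne: "xs \<noteq> []" "ys \<noteq> []" using xy by auto
  note E = P[unfolded simple_walk_def, THEN conjunct2]
  have dist: "distinct ?P" "distinct ?Q" using P by (auto simp: simple_walk_def)
  have V: "set ?P \<subseteq> V" "set ?Q \<subseteq> V" by (intro walk_subset_V E; simp)+
  have R: "simple_walk E (a # [] @ [b])" "simple_walk E (x # [] @ [y])"
    using chords edge_neq by (auto simp: simple_walk_def)
  let ?AB = "edge_image c (a # [] @ [b])" and ?XY = "edge_image c (x # [] @ [y])"
  define I where "I = inside (edge_image c ?P \<union> edge_image c ?Q)"
  have abI: "?AB \<inter> I \<noteq> {}"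
    unfolding I_def by (rule third_path_inside) (use P R ne disj in auto)
  obtain xs1 xs2 where xs: "xs = xs1 @ x # xs2" using xy(1) by (meson split_list)
  obtain ys1 ys2 where ys: "ys = ys1 @ y # ys2" using xy(2) by (meson split_list)
  \<comment> \<open>The same cycle, cut at \<open>x\<close> and \<open>y\<close> instead of
    \<open>a\<close> and \<open>b\<close>, so that the second chord is located inside it in the same
    way.\<close>
  let ?P' = "x # (rev xs1 @ a # ys1) @ [y]" and ?Q' = "x # (xs2 @ b # rev ys2) @ [y]"
  have eP: "path_edges ?P = path_edges (a # xs1 @ [x]) \<union> path_edges (x # xs2 @ [b])"
    using path_edges_append[of "a # xs1" "x # xs2 @ [b]"] path_edges_append[of "a # xs1" "[x]"]
    by (auto simp: xs)
  have eQ: "path_edges ?Q = path_edges (a # ys1 @ [y]) \<union> path_edges (y # ys2 @ [b])"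
    using path_edges_append[of "a # ys1" "y # ys2 @ [b]"] path_edges_append[of "a # ys1" "[y]"]
    by (auto simp: ys)
  have "path_edges ?P' = path_edges (rev (a # xs1 @ [x])) \<union> path_edges (a # ys1 @ [y])"
    using path_edges_append[of "x # rev xs1" "a # ys1 @ [y]"] path_edges_append[of "x # rev xs1" "[a]"]
    by auto
  then have eP': "path_edges ?P' = path_edges (a # xs1 @ [x]) \<union> path_edges (a # ys1 @ [y])"
    by (simp only: path_edges_rev)
  have "path_edges ?Q' = path_edges (x # xs2 @ [b]) \<union> path_edges (rev (y # ys2 @ [b]))"
    using path_edges_append[of "x # xs2" "b # rev ys2 @ [y]"] path_edges_append[of "x # xs2" "[b]"]
    by auto
  then have eQ': "path_edges ?Q' = path_edges (x # xs2 @ [b]) \<union> path_edges (y # ys2 @ [b])"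
    by (simp only: path_edges_rev)
  have un: "edge_image c ?P' \<union> edge_image c ?Q' = edge_image c ?P \<union> edge_image c ?Q"
    unfolding edge_image_def eP eQ eP' eQ' by blast
  have P': "simple_walk E ?P'" "simple_walk E ?Q'"
    unfolding simple_walk_def using dist disj E eP eQ eP' eQ' by (auto simp: xs ys)
  have disj': "set (rev xs1 @ a # ys1) \<inter> set (xs2 @ b # rev ys2) = {}"
    using dist disj by (auto simp: xs ys)
  have xyI: "?XY \<inter> I \<noteq> {}"
    unfolding I_def un[symmetric] by (rule third_path_inside) (use P' R disj' in auto)
  have m: "edge_image c ?P \<inter> edge_image c ?Q = {p a, p b}" "edge_image c ?P \<inter> ?AB = {p a, p b}"
    "edge_image c ?Q \<inter> ?AB = {p a, p b}"
    using two_paths_meet[OF P(1,2) disj ne(1)] two_paths_meet[OF P(1) R(1)] two_paths_meet[OF P(2) R(1)] ne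
    by auto
  have m': "edge_image c ?P' \<inter> ?XY = {p x, p y}" "edge_image c ?Q' \<inter> ?XY = {p x, p y}"
    using two_paths_meet[OF P'(1) R(2)] two_paths_meet[OF P'(2) R(2)] by auto
  have mm: "?XY \<inter> ?AB = {}"
  proof -
    have "?XY \<inter> ?AB \<subseteq> p ` (set [x, y] \<inter> set [a, b])"
      using edge_image_meets[of "[x, y]" "[a, b]"] chords dist xy by (auto simp: doubleton_eq_iff)
    also have "set [x, y] \<inter> set [a, b] = {}" using dist xy by auto
    finally show ?thesis by simp
  qed
  define X where "X = ?XY - {p x, p y}"
  obtain e where e: "arc e" "pathstart e = p x" "pathfinish e = p y" "path_image e = ?XY"
    using simple_walk_arc[OF R(2)] by auto
  have conX: "connected X"
    unfolding X_def using connected_simple_path_endless[OF arc_imp_simple_path[OF e(1)]] e by simp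
  have clX: "{p x, p y} \<subseteq> closure X"
    unfolding X_def using arc_subset_closure_endless[OF e(1)] e
      pathstart_in_path_image[of e] pathfinish_in_path_image[of e] by auto
  have XPQ: "X \<inter> (edge_image c ?P \<union> edge_image c ?Q) = {}"
    using m' un unfolding X_def by blast
  have "X \<inter> I \<noteq> {}"
    using xyI inside_no_overlap[of "edge_image c ?P' \<union> edge_image c ?Q'"] m'
    unfolding I_def un[symmetric] X_def by blast
  then have XI: "X \<subseteq> I"
    unfolding I_def by (intro connected_subset_inside closed_Un closed_edge_image E conX XPQ)
  obtain g where g: "arc g" "pathstart g = p a" "pathfinish g = p b" "path_image g = edge_image c ?P"
    using simple_walk_arc[OF P(1)] by auto
  obtain h where h: "arc h" "pathstart h = p a" "pathfinish h = p b" "path_image h = edge_image c ?Q"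
    using simple_walk_arc[OF P(2)] by auto
  obtain k where k: "arc k" "pathstart k = p a" "pathfinish k = p b" "path_image k = ?AB"
    using simple_walk_arc[OF R(1)] by auto
  have pab: "p a \<noteq> p b" using inj_onD[OF inj_p, of a b] V dist by auto
  have I: "inside (edge_image c ?P \<union> ?AB) \<union> inside (edge_image c ?Q \<union> ?AB) \<union> (?AB - {p a, p b}) = I"
    using split_inside_simple_closed_curve[OF arc_imp_simple_path[OF g(1)] g(2,3)
        arc_imp_simple_path[OF h(1)] h(2,3) arc_imp_simple_path[OF k(1)] k(2,3) pab] m abI
    unfolding g h k I_def by metis
  have ER: "path_edges (a # [] @ [b]) \<subseteq> E" using R(1) by (simp add: simple_walk_def)
  \<comment> \<open>\<open>W\<close> is one side of the cycle, and \<open>z\<close> is the end of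
    the second chord that is not on it; this treats both regions at once.\<close>
  have *: False if "X \<inter> inside (edge_image c W \<union> ?AB) \<noteq> {}" "path_edges W \<subseteq> E"
    "X \<inter> edge_image c W = {}" "z \<in> {x, y}" "z \<notin> set W" "set W \<subseteq> V" "a \<in> set W" "b \<in> set W" for W z
  proof -
    let ?K = "edge_image c W \<union> ?AB"
    have cl: "closed ?K" by (intro closed_Un closed_edge_image that ER)
    have "X \<inter> ?K = {}" using that mm X_def by blast
    then have "X \<subseteq> inside ?K" using that cl conX by (intro connected_subset_inside) auto
    then have "p z \<in> closure (inside ?K)" using clX that closure_mono by blast
    then have "p z \<in> ?K \<union> inside ?K" using closure_inside_subset[OF cl] by blast
    moreover have zV: "z \<in> V" using that xy V by auto
    then have "p z \<notin> inside ?K"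
      by (intro vertex_not_inside cl Un_least edge_image_drawing that ER)
    moreover have "p z \<notin> edge_image c W'" if "path_edges W' \<subseteq> E" "z \<notin> set W'" "set W' \<subseteq> V" for W'
      using edge_image_vertices[OF that(1)] zV that inj_onD[OF inj_p, of z] by blast
    from this[of W] this[of "a # [] @ [b]"] have "p z \<notin> ?K"
      using that ER by auto
    ultimately show False by blast
  qed
  have "X \<noteq> {}" using \<open>X \<inter> I \<noteq> {}\<close> by blast
  moreover have "X \<inter> ?AB = {}" using mm X_def by blast
  ultimately consider "X \<inter> inside (edge_image c ?P \<union> ?AB) \<noteq> {}"
    | "X \<inter> inside (edge_image c ?Q \<union> ?AB) \<noteq> {}"
    using XI I by blast
  moreover have "X \<inter> edge_image c ?P = {}" "X \<inter> edge_image c ?Q = {}" using XPQ by blast+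
  moreover have "y \<notin> set ?P" "x \<notin> set ?Q" using dist xy disj by auto
  ultimately show False
  proof cases
    case 1
    then show False
      by (rule *) (use E V \<open>X \<inter> edge_image c ?P = {}\<close> \<open>y \<notin> set ?P\<close> in auto)
  next
    case 2
    then show False
      by (rule *) (use E V \<open>X \<inter> edge_image c ?Q = {}\<close> \<open>x \<notin> set ?Q\<close> in auto)
  qed
qed

end

subsection \<open>Suppressing a vertex\<close>

definition nbrs :: "'a set set \<Rightarrow> 'a \<Rightarrow> 'a set" where
  "nbrs E v = {w. {v, w} \<in> E}"

text \<open>For degree at most 2 this is deletion or smoothing. Joining all pairs of neighbours
  avoids a case distinction on the degree and preserves exactly the adjacencies of the square that
  run through \<open>v\<close>.\<close>

definition suppress :: "'a set set \<Rightarrow> 'a \<Rightarrow> 'a set set" where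
  "suppress E v = {e \<in> E. v \<notin> e} \<union> {{u, w} | u w. u \<noteq> w \<and> {v, u} \<in> E \<and> {v, w} \<in> E}"

lemma nbrs_commute: "w \<in> nbrs E v \<longleftrightarrow> v \<in> nbrs E w"
  by (simp add: nbrs_def insert_commute)

lemma graph_edgeD:
  assumes "finite_simple_graph V E" "{x, y} \<in> E"
  shows "x \<in> V" "y \<in> V" "x \<noteq> y"
proof -
  have "{x, y} \<subseteq> V" "card {x, y} = 2" using assms by (auto simp: finite_simple_graph_def)
  then show "x \<in> V" "y \<in> V" "x \<noteq> y" by (auto simp: card_insert_if split: if_splits)
qed

lemma nbrs_subset: "finite_simple_graph V E \<Longrightarrow> nbrs E v \<subseteq> V - {v}"
  using graph_edgeD[of V E v] by (auto simp: nbrs_def)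

lemma finite_nbrs: "finite_simple_graph V E \<Longrightarrow> finite (nbrs E v)"
  using finite_subset[OF nbrs_subset, of V E v] by (simp add: finite_simple_graph_def)

lemma finite_simple_graph_suppress:
  assumes "finite_simple_graph V E"
  shows "finite_simple_graph (V - {v}) (suppress E v)"
  unfolding finite_simple_graph_def
proof (intro conjI ballI)
  show "finite (V - {v})" using assms by (simp add: finite_simple_graph_def)
  fix e assume "e \<in> suppress E v"
  then consider "e \<in> E" "v \<notin> e" | u w where "e = {u, w}" "u \<noteq> w" "{v, u} \<in> E" "{v, w} \<in> E"
    by (auto simp: suppress_def)
  then have "e \<subseteq> V - {v} \<and> card e = 2"
  proof cases
    case 1
    then show ?thesis using assms by (auto simp: finite_simple_graph_def)
  next
    case 2
    then show ?thesis using graph_edgeD[OF assms 2(3)] graph_edgeD[OF assms 2(4)] by auto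
  qed
  then show "e \<subseteq> V - {v}" "card e = 2" by auto
qed

context outerplane_graph
begin

text \<open>A smaller drawing has a larger outside, so each vertex remains a limit of outer points;
  lying on the drawing, it is not interior to the outside.\<close>

lemma outerplanar_redraw:
  assumes V': "V' \<subseteq> V" and emb: "plane_embedding V' E' p c'"
    and sub: "drawing V' E' p c' \<subseteq> drawing V E p c"
  shows "outerplanar V' E'"
proof -
  have "p v \<in> frontier (outside (drawing V' E' p c'))" if "v \<in> V'" for v
  proof -
    have "p v \<in> closure (outside (drawing V E p c))"
      using outer V' that by (auto simp: frontier_def)
    then have "p v \<in> closure (outside (drawing V' E' p c'))"
      using closure_mono[OF outside_mono[OF sub]] by blast
    moreover have "p v \<in> drawing V' E' p c'" using that by (simp add: drawing_def)
    then have "p v \<notin> interior (outside (drawing V' E' p c'))"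
      using outside_no_overlap interior_subset by fastforce
    ultimately show ?thesis by (simp add: frontier_def)
  qed
  then show ?thesis using emb by (auto simp: outerplanar_def)
qed

lemma outerplanar_subgraph:
  assumes "V' \<subseteq> V" "E' \<subseteq> E" "\<And>e. e \<in> E' \<Longrightarrow> e \<subseteq> V'"
  shows "outerplanar V' E'"
proof (rule outerplanar_redraw)
  have "path_image (c e) \<inter> p ` V' = p ` e" if "e \<in> E'" for e
  proof -
    have "p ` e \<subseteq> p ` V'" using assms(3)[OF that] by blast
    then show ?thesis using edge_meets_vertices[of e] assms that by blast
  qed
  moreover have "e \<in> E" if "e \<in> E'" for e using that assms(2) by blast
  ultimately show "plane_embedding V' E' p c"
    unfolding plane_embedding_def
    using inj_on_subset[OF inj_p assms(1)] edge_arc edge_ends edges_meet by metis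
  show "drawing V' E' p c \<subseteq> drawing V E p c" using assms by (auto simp: drawing_def)
qed (use assms in auto)

text \<open>The new edge is drawn along the two old ones through \<open>v\<close>, so the drawing
  gains no points.\<close>

lemma outerplanar_suppress_path:
  assumes N: "nbrs E v = {u, w}" "u \<noteq> w" and uw: "{u, w} \<notin> E"
  shows "outerplanar (V - {v}) (suppress E v)"
proof -
  have vE: "{v, u} \<in> E" "{v, w} \<in> E" using N by (auto simp: nbrs_def)
  note vV = graph_edgeD[OF graph vE(1)] graph_edgeD[OF graph vE(2)]
  have S: "suppress E v = {e \<in> E. v \<notin> e} \<union> {{u, w}}"
  proof -
    have "{x, y} = {u, w}" if "{v, x} \<in> E" "{v, y} \<in> E" "x \<noteq> y" for x y
    proof -
      have "x \<in> {u, w}" "y \<in> {u, w}" using that N by (auto simp: nbrs_def)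
      then show ?thesis using that(3) by auto
    qed
    then show ?thesis using vE N(2) unfolding suppress_def by blast
  qed
  have "simple_walk E [u, v, w]"
    using vE vV N by (auto simp: simple_walk_def insert_commute)
  then obtain g where g: "arc g" "pathstart g = p u" "pathfinish g = p w"
    "path_image g = path_image (c {v, u}) \<union> path_image (c {v, w})"
    using simple_walk_arc[of "[u, v, w]"] by (auto simp: edge_image_def insert_commute)
  let ?c = "c({u, w} := g)"
  have c_old: "?c e = c e" if "e \<in> E" for e using that uw by auto
  have pv: "p v \<notin> p ` (V - {v})" using inj_p vV by (auto dest: inj_onD)
  have *: "path_image (?c e) \<inter> p ` (V - {v}) = p ` e" if e: "e \<in> E" "v \<notin> e" for e
  proof -
    have "e \<subseteq> V - {v}" using e edge_subset by blast
    then have "p ` e \<subseteq> p ` (V - {v})" by blast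
    then show ?thesis using edge_meets_vertices[OF e(1)] c_old[OF e(1)] by auto
  qed
  have gV: "path_image g \<inter> p ` (V - {v}) = p ` {u, w}"
  proof -
    have "path_image g \<inter> p ` (V - {v}) = (p ` {v, u} \<union> p ` {v, w}) \<inter> p ` (V - {v})"
      using edge_meets_vertices[OF vE(1)] edge_meets_vertices[OF vE(2)] g(4) by blast
    also have "\<dots> = p ` {u, w}" using pv vV by blast
    finally show ?thesis .
  qed
  have gm: "path_image g \<inter> path_image (c e) \<subseteq> p ` ({u, w} \<inter> e)" if e: "e \<in> E" "v \<notin> e" for e
  proof -
    have "e \<noteq> {v, u}" "e \<noteq> {v, w}" using e by auto
    then have "path_image g \<inter> path_image (c e) \<subseteq> p ` ({v, u} \<inter> e) \<union> p ` ({v, w} \<inter> e)"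
      using edges_meet[OF vE(1) e(1)] edges_meet[OF vE(2) e(1)] g(4) by blast
    also have "\<dots> \<subseteq> p ` ({u, w} \<inter> e)" using e by blast
    finally show ?thesis .
  qed
  show ?thesis
  proof (rule outerplanar_redraw)
    show "plane_embedding (V - {v}) (suppress E v) p ?c"
      unfolding plane_embedding_def
    proof (intro conjI ballI impI)
      show "inj_on p (V - {v})" using inj_p by (rule inj_on_subset) blast
    next
      fix e assume e: "e \<in> suppress E v"
      show "arc (?c e)" using e S g(1) edge_arc by auto
      show "{pathstart (?c e), pathfinish (?c e)} = p ` e"
      proof (cases "e = {u, w}")
        case True
        then show ?thesis using g by simp
      next
        case False
        then have "e \<in> E" using e S by blast
        then show ?thesis using c_old edge_ends by simp
      qed
      show "path_image (?c e) \<inter> p ` (V - {v}) = p ` e"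
      proof (cases "e = {u, w}")
        case True
        then show ?thesis using gV by simp
      next
        case False
        then show ?thesis using * e S by blast
      qed
    next
      fix e f assume ef: "e \<in> suppress E v" "f \<in> suppress E v" "e \<noteq> f"
      consider "e = {u, w}" "f \<in> E" "v \<notin> f" | "f = {u, w}" "e \<in> E" "v \<notin> e"
        | "e \<in> E" "v \<notin> e" "f \<in> E" "v \<notin> f" using ef S by blast
      then show "path_image (?c e) \<inter> path_image (?c f) \<subseteq> p ` (e \<inter> f)"
      proof cases
        case 1
        then show ?thesis using gm c_old by auto
      next
        case 2
        then have "path_image (?c e) \<inter> path_image (?c f) = path_image g \<inter> path_image (c e)"
          using c_old by auto
        then show ?thesis using gm 2 by (metis Int_commute)
      next
        case 3
        then show ?thesis using edges_meet ef c_old by auto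
      qed
    qed
    have "path_image (?c e) \<subseteq> drawing V E p c" if "e \<in> suppress E v" for e
    proof (cases "e = {u, w}")
      case True
      then show ?thesis using g(4) vE by (auto simp: drawing_def)
    next
      case False
      then have "e \<in> E" using that S by blast
      then show ?thesis using c_old by (auto simp: drawing_def)
    qed
    then show "drawing (V - {v}) (suppress E v) p ?c \<subseteq> drawing V E p c"
      unfolding drawing_def[of "V - {v}"] by (auto simp: drawing_def)
  qed auto
qed

lemma outerplanar_suppress:
  assumes "card (nbrs E v) \<le> 2"
  shows "outerplanar (V - {v}) (suppress E v)"
proof (cases "suppress E v \<subseteq> E")
  case True
  then show ?thesis
    using finite_simple_graph_suppress[OF graph, of v]
    by (intro outerplanar_subgraph) (auto simp: finite_simple_graph_def)
next
  case False
  then obtain u w where uw: "u \<noteq> w" "{v, u} \<in> E" "{v, w} \<in> E" "{u, w} \<notin> E"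
    by (auto simp: suppress_def)
  then have "{u, w} \<subseteq> nbrs E v" by (auto simp: nbrs_def)
  moreover have "card {u, w} = 2" using uw by simp
  ultimately have "nbrs E v = {u, w}"
    using card_seteq[OF finite_nbrs[OF graph], of "{u, w}" v] assms by auto
  then show ?thesis using uw by (intro outerplanar_suppress_path)
qed

end

subsection \<open>Vertices of small degree\<close>

context outerplane_graph
begin

text \<open>The edge \<open>{a, t}\<close> closes the walk up to \<open>t\<close> to a cycle, in
  which \<open>{a, b}\<close> and \<open>{q, s}\<close> are crossing chords.\<close>

lemma no_crossing_edges_along_walk:
  assumes m: "simple_walk E (a # m @ b # rest)" and ab: "{a, b} \<in> E"
    and rest: "rest = r1 @ t # r2" and at: "{a, t} \<in> E"
    and q: "q \<in> set m" "s \<in> insert t (set r1)" "{q, s} \<in> E"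
  shows False
proof (rule no_crossing_chords)
  have pe: "path_edges (a # m @ b # rest) =
      path_edges (a # m @ [b]) \<union> path_edges (b # rest)"
    using path_edges_append[of "a # m" "b # rest"] path_edges_append[of "a # m" "[b]"] by auto
  have pr: "path_edges (b # r1 @ [t]) \<subseteq> path_edges (b # rest)"
    using path_edges_append[of "b # r1" "t # r2"] path_edges_append[of "b # r1" "[t]"]
    by (auto simp: rest)
  show "simple_walk E (a # m @ [b])"
    using m pe by (auto simp: simple_walk_def)
  have "path_edges (rev (b # r1 @ [t])) \<subseteq> E"
    unfolding path_edges_rev using pr pe m by (auto simp: simple_walk_def)
  then show "simple_walk E (a # (t # rev r1) @ [b])"
    using m at by (auto simp: simple_walk_def rest)
  show "set m \<inter> set (t # rev r1) = {}"
    using m by (auto simp: simple_walk_def rest)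
  show "q \<in> set m" "s \<in> set (t # rev r1)" "{a, b} \<in> E" "{q, s} \<in> E"
    using q ab by auto
qed

lemma ex_longest_walk:
  assumes "V \<noteq> {}"
  obtains L where "\<And>xs. simple_walk E xs \<Longrightarrow> set xs \<subseteq> V \<Longrightarrow> length xs \<le> L"
    "\<exists>xs. simple_walk E xs \<and> set xs \<subseteq> V \<and> length xs = L" "L > 0"
proof -
  let ?W = "{xs. simple_walk E xs \<and> set xs \<subseteq> V}"
  have fin: "finite V" using graph by (simp add: finite_simple_graph_def)
  have "finite ?W"
    by (rule finite_subset[OF _ finite_subset_distinct[OF fin]]) (auto simp: simple_walk_def)
  obtain v where v: "v \<in> V" using assms by auto
  have v': "[v] \<in> ?W" using v by (simp add: simple_walk_def)
  have fl: "finite (length ` ?W)" using \<open>finite ?W\<close> by simp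
  show thesis
  proof (rule that[of "Max (length ` ?W)"])
    show "length xs \<le> Max (length ` ?W)" if "simple_walk E xs" "set xs \<subseteq> V" for xs
      using that by (intro Max_ge fl) auto
    have "Max (length ` ?W) \<in> length ` ?W" using v' by (intro Max_in fl) auto
    then show "\<exists>xs. simple_walk E xs \<and> set xs \<subseteq> V \<and> length xs = Max (length ` ?W)" by auto
    have "length [v] \<le> Max (length ` ?W)" using v' by (intro Max_ge fl) blast
    then show "Max (length ` ?W) > 0" by simp
  qed
qed

text \<open>Take a longest path and, among these, one whose first vertex has a neighbour as early as
  possible after its successor.  Reversing the initial segment up to that neighbour gives another
  longest path, and the two end vertices yield crossing chords.\<close>

lemma ex_vertex_degree_le_2:
  assumes "V \<noteq> {}"
  shows "\<exists>v\<in>V. card (nbrs E v) \<le> 2"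
proof (rule ccontr)
  assume "\<not> ?thesis"
  then have deg: "card (nbrs E v) \<ge> 3" if "v \<in> V" for v using that by force
  obtain L where Lmax: "\<And>xs. simple_walk E xs \<Longrightarrow> set xs \<subseteq> V \<Longrightarrow> length xs \<le> L"
    and Lex: "\<exists>xs. simple_walk E xs \<and> set xs \<subseteq> V \<and> length xs = L" and "L > 0"
    using ex_longest_walk[OF assms] by blast
  define W where "W = {xs. simple_walk E xs \<and> set xs \<subseteq> V \<and> length xs = L}"
  \<comment> \<open>Otherwise the walk could be prolonged at its front.\<close>
  have nb: "nbrs E (xs ! 0) \<subseteq> set xs" if "xs \<in> W" for xs
  proof
    fix y assume y: "y \<in> nbrs E (xs ! 0)"
    show "y \<in> set xs"
    proof (rule ccontr)
      assume "y \<notin> set xs"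
      have "xs \<noteq> []" using that \<open>L > 0\<close> by (auto simp: W_def)
      then obtain x xs' where xs: "xs = x # xs'" by (cases xs) auto
      have yx: "{x, y} \<in> E" using y by (simp add: nbrs_def xs)
      then have "simple_walk E (y # xs)"
        using that \<open>y \<notin> set xs\<close> by (auto simp: W_def simple_walk_def xs insert_commute)
      moreover have "set (y # xs) \<subseteq> V" using that graph_edgeD[OF graph yx] by (auto simp: W_def)
      ultimately show False using Lmax[of "y # xs"] that by (auto simp: W_def)
    qed
  qed
  \<comment> \<open>If all neighbours of the first vertex were at the positions 1 and
    \<open>i\<close>, its degree would be at most 2. For \<open>i = 1\<close> the gap condition is
    vacuous.\<close>
  have many: "\<exists>j. i < j \<and> j < L \<and> {xs ! 0, xs ! j} \<in> E"
    if xsW: "xs \<in> W" and "i \<ge> 1" and gap: "\<And>j. 2 \<le> j \<Longrightarrow> j < i \<Longrightarrow> {xs ! 0, xs ! j} \<notin> E" for xs i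
  proof (rule ccontr)
    assume no: "\<not> ?thesis"
    have "nbrs E (xs ! 0) \<subseteq> {xs ! 1, xs ! i}"
    proof
      fix y assume y: "y \<in> nbrs E (xs ! 0)"
      then have "y \<in> set xs" using nb[OF xsW] by blast
      then obtain j where j: "j < L" "y = xs ! j"
        using xsW unfolding in_set_conv_nth W_def by blast
      have yE: "{xs ! 0, xs ! j} \<in> E" using y j by (simp add: nbrs_def)
      then have "j \<noteq> 0" using edge_neq[OF yE] by (intro notI) simp
      moreover have "\<not> i < j" using no j yE by blast
      moreover have "\<not> (2 \<le> j \<and> j < i)" using gap yE by blast
      ultimately have "j = 1 \<or> j = i" by linarith
      then show "y \<in> {xs ! 1, xs ! i}" using j by auto
    qed
    then have "card (nbrs E (xs ! 0)) \<le> card {xs ! 1, xs ! i}" by (intro card_mono) auto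
    also have "\<dots> \<le> 2" by (simp add: card_insert_if)
    finally have "card (nbrs E (xs ! 0)) \<le> 2" .
    moreover have "xs ! 0 \<in> V" using that(1) \<open>L > 0\<close> nth_mem[of 0 xs] by (auto simp: W_def)
    ultimately show False using deg[of "xs ! 0"] by simp
  qed
  let ?Q = "\<lambda>i. \<exists>xs\<in>W. 2 \<le> i \<and> i < L \<and> {xs ! 0, xs ! i} \<in> E"
  obtain xs0 where xs0: "xs0 \<in> W" using Lex by (auto simp: W_def)
  have "\<exists>j>1. j < L \<and> {xs0 ! 0, xs0 ! j} \<in> E" using many[OF xs0, of 1] by simp
  then have "\<exists>i. ?Q i" using xs0 by (metis Suc_1 Suc_leI One_nat_def)
  then obtain i where i: "?Q i" and min: "\<And>j. j < i \<Longrightarrow> \<not> ?Q j"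
    using exists_least_iff[of ?Q] by blast
  have later: "\<exists>j. i < j \<and> j < L \<and> {xs ! 0, xs ! j} \<in> E" if "xs \<in> W" for xs
    using many[OF that, of i] i min that by fastforce
  obtain xs where xs: "xs \<in> W" "2 \<le> i" "i < L" "{xs ! 0, xs ! i} \<in> E" using i by blast
  have len: "length xs = L" using xs by (simp add: W_def)
  define a where "a = xs ! 0"
  define z where "z = xs ! (i - 1)"
  define b where "b = xs ! i"
  define bs where "bs = take (i - 2) (drop 1 xs)"
  define rest where "rest = drop (i + 1) xs"
  have lbs: "length bs = i - 2" using len xs by (simp add: bs_def)
  have eq: "xs = a # (bs @ [z]) @ b # rest"
  proof (rule nth_equalityI)
    show "length xs = length (a # (bs @ [z]) @ b # rest)"
      using len xs by (simp add: bs_def rest_def)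
    fix k assume k: "k < length xs"
    consider "k = 0" | "1 \<le> k" "k < i - 1" | "k = i - 1" "k \<ge> 1" | "k = i" | "i < k" using xs by linarith
    then show "xs ! k = (a # (bs @ [z]) @ b # rest) ! k"
    proof cases
      case 2
      then show ?thesis using xs len lbs by (auto simp: nth_append nth_Cons' bs_def)
    qed (use xs len lbs k in \<open>auto simp: nth_append nth_Cons' rest_def a_def b_def z_def Suc_diff_Suc\<close>)
  qed
  have sw: "simple_walk E (a # (bs @ [z]) @ b # rest)" and V: "set xs \<subseteq> V"
    using xs eq by (auto simp: W_def)
  have ab: "{a, b} \<in> E" using xs by (simp add: a_def b_def)
  \<comment> \<open>Exchanging the edge \<open>{z, b}\<close> for \<open>{a, b}\<close> reverses the
    segment from \<open>a\<close> to \<open>z\<close> and leaves \<open>b\<close> at position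
    \<open>i\<close>. By minimality of \<open>i\<close> both \<open>a\<close> and \<open>z\<close>
    have neighbours beyond \<open>b\<close>.\<close>
  let ?ys = "z # (rev bs @ [a]) @ b # rest"
  have pe: "path_edges xs = path_edges (a # bs @ [z]) \<union> {{z, b}} \<union> path_edges (b # rest)"
    using path_edges_append[of "a # bs @ [z]" "b # rest"] by (simp add: eq)
  have "path_edges ?ys = path_edges (rev (a # bs @ [z])) \<union> {{a, b}} \<union> path_edges (b # rest)"
    using path_edges_append[of "z # rev bs @ [a]" "b # rest"] by simp
  then have pe': "path_edges ?ys = path_edges (a # bs @ [z]) \<union> {{a, b}} \<union> path_edges (b # rest)"
    by (simp only: path_edges_rev)
  have sw': "simple_walk E ?ys"
    using sw ab pe pe' unfolding eq by (auto simp: simple_walk_def)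
  have zb: "{z, b} \<in> E" using sw pe unfolding eq by (auto simp: simple_walk_def)
  have "length ?ys = length xs" by (subst eq) simp
  then have "?ys \<in> W" using sw' V eq len by (auto simp: W_def)
  obtain t where t: "t \<in> set rest" "{a, t} \<in> E"
  proof -
    obtain j where j: "i < j" "j < L" "{xs ! 0, xs ! j} \<in> E" using later[OF xs(1)] by blast
    have "xs ! j \<in> set rest"
      unfolding rest_def using j len by (auto simp: in_set_conv_nth intro!: exI[of _ "j - (i + 1)"])
    then show ?thesis using that j a_def by auto
  qed
  obtain y where y: "y \<in> set rest" "{z, y} \<in> E"
  proof -
    obtain j where j: "i < j" "j < L" "{?ys ! 0, ?ys ! j} \<in> E" using later[OF \<open>?ys \<in> W\<close>] by blast
    have "?ys = (z # (rev bs @ [a]) @ [b]) @ rest" by simp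
    moreover have "length (z # (rev bs @ [a]) @ [b]) = i + 1" using lbs xs by simp
    ultimately have "?ys ! j = rest ! (j - (i + 1))" using j by (metis nth_append Suc_eq_plus1 not_less_eq)
    moreover have "j - (i + 1) < length rest" using j len by (simp add: rest_def)
    ultimately have "?ys ! j \<in> set rest" by simp
    then show ?thesis using that j by auto
  qed
  obtain r1 r2 where r: "rest = r1 @ t # r2" using t(1) by (meson split_list)
  show False
  \<comment> \<open>The later of \<open>t\<close> and \<open>y\<close> closes the cycle, in the
    original walk if it is \<open>t\<close> and in the reversed one if it is \<open>y\<close>; the
    edge to the other is then a crossing chord.\<close>
  proof (cases "y \<in> insert t (set r1)")
    case True
    show False
      by (rule no_crossing_edges_along_walk[OF sw ab r t(2) _ True y(2)]) simp
  next
    case False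
    then have "y \<in> set r2" using y(1) r by auto
    then obtain s1 s2 where "r2 = s1 @ y # s2" by (meson split_list)
    then have r': "rest = (r1 @ t # s1) @ y # s2" using r by simp
    show False
      by (rule no_crossing_edges_along_walk[OF sw' zb r' y(2) _ _ t(2)]) auto
  qed
qed

end

subsection \<open>Noncrossing circular orders\<close>

text \<open>A circular drawing cut open at some point; the place of the cut does not matter. Integer
  values leave room for rotating by shifts and for inserting vertices after scaling.\<close>

definition noncrossing :: "'a set set \<Rightarrow> ('a \<Rightarrow> int) \<Rightarrow> bool" where
  "noncrossing E f \<longleftrightarrow>
    (\<forall>a b c d. {a, c} \<in> E \<longrightarrow> {b, d} \<in> E \<longrightarrow> \<not> (f a < f b \<and> f b < f c \<and> f c < f d))"

lemma noncrossingD: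
  "noncrossing E f \<Longrightarrow> {a, c} \<in> E \<Longrightarrow> {b, d} \<in> E \<Longrightarrow> f a < f b \<Longrightarrow> f b < f c \<Longrightarrow> f c < f d \<Longrightarrow> False"
  unfolding noncrossing_def by blast

lemma noncrossing_cyclic:
  assumes "noncrossing E f" "{a, c} \<in> E" "{b, d} \<in> E"
  shows "\<not> (f a < f b \<and> f b < f c \<and> f c < f d)" "\<not> (f b < f c \<and> f c < f d \<and> f d < f a)"
    "\<not> (f c < f d \<and> f d < f a \<and> f a < f b)" "\<not> (f d < f a \<and> f a < f b \<and> f b < f c)"
  using noncrossingD[OF assms(1), of a c b d] noncrossingD[OF assms(1), of b d c a]
    noncrossingD[OF assms(1), of c a d b] noncrossingD[OF assms(1), of d b a c] assms(2,3)
  by (auto simp: insert_commute)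

text \<open>Shifting by \<open>t\<close> and lifting what falls below 0 by \<open>M\<close> rotates
  the circle: \<open>M\<close> exceeds all differences of values, so the lifted part lands above the
  rest.\<close>

lemma noncrossing_rotate:
  fixes t :: int
  assumes nc: "noncrossing E f" and E: "\<And>e. e \<in> E \<Longrightarrow> e \<subseteq> V"
    and inj: "inj_on f V" and M: "\<And>x y. x \<in> V \<Longrightarrow> y \<in> V \<Longrightarrow> f x < f y + M"
  defines "g \<equiv> \<lambda>x. if f x \<ge> t then f x - t else f x - t + M"
  shows "inj_on g V" "noncrossing E g"
proof -
  show "inj_on g V"
  proof (rule inj_onI)
    fix x y assume "x \<in> V" "y \<in> V" "g x = g y"
    then have "f x = f y" using M[of x y] M[of y x] by (auto simp: g_def split: if_splits)
    then show "x = y" using inj \<open>x \<in> V\<close> \<open>y \<in> V\<close> by (auto dest: inj_onD)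
  qed
  show "noncrossing E g"
    unfolding noncrossing_def
  proof (intro allI impI notI)
    fix a b c d assume e: "{a, c} \<in> E" "{b, d} \<in> E" and gg: "g a < g b \<and> g b < g c \<and> g c < g d"
    have V: "a \<in> V" "b \<in> V" "c \<in> V" "d \<in> V" using E[OF e(1)] E[OF e(2)] by auto
    have *: "f x < f y \<and> (t \<le> f x \<or> f y < t) \<or> f y < t \<and> t \<le> f x"
      if "x \<in> V" "y \<in> V" "g x < g y" for x y
      using that M[of y x] by (auto simp: g_def split: if_splits)
    show False
      using noncrossing_cyclic[OF nc e] gg *[OF V(1,2)] *[OF V(2,3)] *[OF V(3,4)] by linarith
  qed
qed

text \<open>Placed directly after \<open>u\<close>, the vertex \<open>v\<close> has an edge with
  consecutive ends, which nothing can cross; doubling frees the odd value for it. An isolated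
  \<open>v\<close> is included.\<close>

lemma noncrossing_insert_leaf:
  assumes graph: "finite_simple_graph V E" and N: "nbrs E v \<subseteq> {u}"
    and inj: "inj_on f (V - {v})" and nc: "noncrossing (suppress E v) f"
  defines "g \<equiv> \<lambda>x. if x = v then 2 * f u + 1 else 2 * f x"
  shows "inj_on g V" "noncrossing E g"
proof -
  show "inj_on g V"
  proof (rule inj_onI)
    fix x y assume "x \<in> V" "y \<in> V" "g x = g y"
    moreover have "2 * f u + 1 \<noteq> 2 * f z" "2 * f z \<noteq> 2 * f u + 1" for z by presburger+
    ultimately show "x = y" using inj_onD[OF inj, of x y] by (auto simp: g_def split: if_splits)
  qed
  have u: "x = v \<and> y = u \<or> x = u \<and> y = v \<or> x \<noteq> v \<and> y \<noteq> v \<and> {x, y} \<in> suppress E v"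
    if "{x, y} \<in> E" for x y
    using that N by (auto simp: nbrs_def suppress_def insert_commute)
  show "noncrossing E g"
    unfolding noncrossing_def
  proof (intro allI impI notI)
    fix a b c d assume e: "{a, c} \<in> E" "{b, d} \<in> E" and g: "g a < g b \<and> g b < g c \<and> g c < g d"
    have "u \<noteq> v" if "{x, y} \<in> E" "x = v \<and> y = u \<or> x = u \<and> y = v" for x y
      using graph_edgeD[OF graph that(1)] that(2) by auto
    then have "a \<noteq> v \<and> c \<noteq> v \<and> {a, c} \<in> suppress E v" "b \<noteq> v \<and> d \<noteq> v \<and> {b, d} \<in> suppress E v"
      using u[OF e(1)] u[OF e(2)] g e unfolding g_def by (auto split: if_splits)
    then show False using noncrossingD[OF nc, of a c b d] g unfolding g_def by auto
  qed
qed

section \<open>Reinserting a vertex of degree 2\<close>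

definition reach :: "'a set set \<Rightarrow> 'a set \<Rightarrow> 'a \<Rightarrow> 'a set" where
  "reach E I u = {x. (u, x) \<in> {(x, y). {x, y} \<in> E \<and> y \<in> I}\<^sup>+}"

lemma reach_subset: "reach E I u \<subseteq> I"
  unfolding reach_def by (auto elim: tranclE)

lemma reach_start: "{u, x} \<in> E \<Longrightarrow> x \<in> I \<Longrightarrow> x \<in> reach E I u"
  unfolding reach_def by (auto intro: r_into_trancl)

lemma reach_step: "x \<in> reach E I u \<Longrightarrow> {x, y} \<in> E \<Longrightarrow> y \<in> I \<Longrightarrow> y \<in> reach E I u"
  unfolding reach_def by (auto intro: trancl_into_trancl)

text \<open>When the next vertex already occurs, the walk is cut back to it and so stays
  simple.\<close>

lemma walk_of_reach:
  assumes "x \<in> reach E I u" "u \<notin> I"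
  shows "\<exists>xs. simple_walk E (u # xs @ [x]) \<and> set xs \<subseteq> I"
proof -
  have "(u, x) \<in> {(x, y). {x, y} \<in> E \<and> y \<in> I}\<^sup>+" using assms(1) by (simp add: reach_def)
  then show ?thesis
  proof (induction rule: trancl_induct)
    case (base y)
    then show ?case using assms(2) by (intro exI[of _ "[]"]) (auto simp: simple_walk_def)
  next
    case (step y z)
    then obtain xs where xs: "simple_walk E (u # xs @ [y])" "set xs \<subseteq> I" by blast
    have "y \<in> I" using step(1) by (auto elim: tranclE)
    have z: "{y, z} \<in> E" "z \<in> I" using step(2) by auto
    show ?case
    proof (cases "z \<in> set (xs @ [y])")
      case True
      then obtain p q where pq: "xs @ [y] = p @ z # q" by (meson split_list)
      have "simple_walk E (u # p @ [z])"
        using xs(1) path_edges_append[of "u # p" "z # q"] path_edges_append[of "u # p" "[z]"]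
        unfolding pq by (auto simp: simple_walk_def)
      moreover have "set p \<subseteq> set (xs @ [y])" unfolding pq by auto
      ultimately show ?thesis using xs(2) \<open>y \<in> I\<close> by (intro exI[of _ p]) auto
    next
      case False
      have "simple_walk E (u # (xs @ [y]) @ [z])"
        using xs(1) False z assms(2) path_edges_append[of "u # xs @ [y]" "[z]"]
        by (auto simp: simple_walk_def)
      then show ?thesis using xs(2) \<open>y \<in> I\<close> by (intro exI[of _ "xs @ [y]"]) auto
    qed
  qed
qed

text \<open>The part of the interval between \<open>u\<close> and \<open>w\<close> that is connected to \<open>u\<close> is moved in front of
  \<open>u\<close>, and \<open>w\<close> is moved in front of the remaining part; then \<open>v\<close> fits between \<open>u\<close> and \<open>w\<close>.\<close>

lemma noncrossing_insert_between:
  assumes graph: "finite_simple_graph V E" and N: "nbrs E v = {u, w}" "u \<noteq> w"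
    and inj: "inj_on f (V - {v})" and nc: "noncrossing (suppress E v) f"
    and fu: "f u = 0" and fpos: "\<And>x. x \<in> V - {v} \<Longrightarrow> x \<noteq> u \<Longrightarrow> 0 < f x"
  defines "I \<equiv> {x \<in> V - {v}. 0 < f x \<and> f x < f w}"
  assumes sep: "\<And>x. x \<in> reach E I u \<Longrightarrow> {x, w} \<notin> E"
  shows "\<exists>g. inj_on g V \<and> noncrossing E g"
proof -
  define A where "A = reach E I u"
  have fin: "finite (f ` (V - {v}))" using graph by (simp add: finite_simple_graph_def)
  define M where "M = Max (f ` (V - {v})) + 1"
  have M: "f x < M" if "x \<in> V - {v}" for x
    using Max_ge[OF fin, of "f x"] that by (simp add: M_def)
  \<comment> \<open>The new order is \<open>A\<close>, \<open>u\<close>, \<open>v\<close>,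
    \<open>w\<close>, the rest of \<open>I\<close>, the vertices beyond \<open>w\<close>. The factor
    4 frees the values 1 and 2, and subtracting \<open>4 * M\<close> makes all of \<open>A\<close>
    negative.\<close>
  define g where "g x = (if x \<in> A then 4 * f x - 4 * M else if x = v then 1
    else if x = w then 2 else 4 * f x)" for x
  have AI: "A \<subseteq> I" using reach_subset by (simp add: A_def)
  have uwE: "{v, u} \<in> E" "{v, w} \<in> E" using N by (auto simp: nbrs_def)
  note uw = graph_edgeD[OF graph uwE(1)] graph_edgeD[OF graph uwE(2)]
  have uwS: "{u, w} \<in> suppress E v" using uwE N(2) by (auto simp: suppress_def)
  have notA: "u \<notin> A" "v \<notin> A" "w \<notin> A" using AI fu by (auto simp: I_def)
  have gvals: "g u = 0" "g v = 1" "g w = 2" using notA uw N(2) fu by (auto simp: g_def)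
  have fw: "0 < f w" using fpos[of w] uw N(2) by auto
  have finj: "f x = f y \<Longrightarrow> x \<in> V - {v} \<Longrightarrow> y \<in> V - {v} \<Longrightarrow> x = y" for x y
    using inj by (auto dest: inj_onD)
  have part: "x \<in> A \<or> x = u \<or> x = v \<or> x = w \<or> x \<in> I - A \<or> x \<in> V - {v} \<and> f w < f x" if "x \<in> V" for x
    using that fpos[of x] finj[of x w] uw by (fastforce simp: I_def)
  have gA: "x \<in> A \<Longrightarrow> g x = 4 * f x - 4 * M \<and> 0 < f x \<and> f x < f w \<and> f x < M" for x
    using AI M[of x] by (auto simp: g_def I_def)
  have gB: "x \<in> I - A \<Longrightarrow> g x = 4 * f x \<and> 0 < f x \<and> f x < f w \<and> f x < M" for x
    using M[of x] by (auto simp: g_def I_def)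
  have gJ: "x \<in> V - {v} \<Longrightarrow> f w < f x \<Longrightarrow> g x = 4 * f x \<and> f x < M" for x
    using M[of x] AI by (auto simp: g_def I_def)
  have "inj_on g V"
  proof (rule inj_onI)
    fix x y assume xy: "x \<in> V" "y \<in> V" "g x = g y"
    have gcase: "x \<in> V - {v} \<and> g x = 4 * f x - 4 * M \<and> g x < 0 \<or> g x = 0 \<and> x = u \<or> g x = 1 \<and> x = v \<or>
      g x = 2 \<and> x = w \<or> x \<in> V - {v} \<and> g x = 4 * f x \<and> g x \<ge> 4" if xV: "x \<in> V" for x
    proof -
      consider "x \<in> A" | "x = u" | "x = v" | "x = w" | "x \<in> I - A" | "x \<in> V - {v}" "f w < f x"
        using part[OF xV] by blast
      then show ?thesis
      proof cases
        case 1
        then have "x \<in> V - {v}" using AI I_def by blast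
        moreover have "g x = 4 * f x - 4 * M" "f x < M" using gA[OF 1] by blast+
        moreover from this have "g x < 0" by linarith
        ultimately show ?thesis by blast
      next
        case 5
        then have "x \<in> V - {v}" using I_def by blast
        moreover have "g x = 4 * f x" "0 < f x" using gB[OF 5] by blast+
        moreover from this have "g x \<ge> 4" by linarith
        ultimately show ?thesis by blast
      next
        case 6
        have "g x = 4 * f x" using gJ[OF 6] by blast
        moreover from this have "g x \<ge> 4" using fw 6(2) by linarith
        ultimately show ?thesis using 6(1) by blast
      qed (use gvals in blast)+
    qed
    have *: "f x = f y \<Longrightarrow> x \<in> V - {v} \<Longrightarrow> y \<in> V - {v} \<Longrightarrow> x = y" by (rule finj)
    show "x = y"
      using gcase[OF xy(1)] gcase[OF xy(2)] xy(3) by (elim disjE conjE) (auto intro: *)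
  qed
  \<comment> \<open>Each edge avoiding \<open>v\<close> stays in one of three classes, on each of
    which \<open>g\<close> keeps the cyclic order of \<open>f\<close>: on \<open>K1\<close> the
    vertex \<open>u\<close> moves from the front to the back, on \<open>K2\<close> the vertex
    \<open>w\<close> from the back to the front, on \<open>K3\<close> nothing moves. Edges of
    different classes cannot cross, because \<open>K1\<close> and \<open>K2\<close> occupy arcs that
    meet \<open>K3\<close> only in \<open>u\<close> and \<open>w\<close>.\<close>
  define K1 where "K1 x \<longleftrightarrow> x \<in> A \<or> x = u" for x
  define K2 where "K2 x \<longleftrightarrow> x \<in> I - A \<or> x = w" for x
  define K3 where "K3 x \<longleftrightarrow> x \<in> V - {v} \<and> f w < f x \<or> x = u \<or> x = w" for x
  have cls: "{x, y} \<in> suppress E v \<and> (K1 x \<and> K1 y \<or> K2 x \<and> K2 y \<or> K3 x \<and> K3 y)"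
    if xy: "{x, y} \<in> E" "x \<noteq> v" "y \<noteq> v" for x y
  proof -
    have S: "{x, y} \<in> suppress E v" "{y, x} \<in> suppress E v"
      using xy by (auto simp: suppress_def insert_commute)
    note V = graph_edgeD[OF graph xy(1)]
    \<comment> \<open>The edge \<open>{u, w}\<close> of the suppressed graph shields the interval
      from the vertices beyond \<open>w\<close>.\<close>
    have sep': "\<not> (s \<in> I \<and> t \<in> V - {v} \<and> f w < f t)" if "{s, t} \<in> suppress E v" for s t
      using noncrossingD[OF nc uwS that] fu by (auto simp: I_def)
    have "\<not> (s \<in> A \<and> t = w)" "\<not> (s \<in> A \<and> t \<in> I - A)" "\<not> (s = u \<and> t \<in> I - A)" if "{s, t} \<in> E" for s t
      using that sep[of s] reach_step[of s E I u t] reach_start[of u t E I] by (auto simp: A_def)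
    from this[of x y] this[of y x] have "\<not> (x \<in> A \<and> y = w)" "\<not> (x \<in> A \<and> y \<in> I - A)" "\<not> (x = u \<and> y \<in> I - A)"
      "\<not> (y \<in> A \<and> x = w)" "\<not> (y \<in> A \<and> x \<in> I - A)" "\<not> (y = u \<and> x \<in> I - A)"
      using xy(1) by (auto simp: insert_commute)
    moreover have "x \<in> A \<longrightarrow> x \<in> I" "y \<in> A \<longrightarrow> y \<in> I" using AI by auto
    ultimately show ?thesis
      using part[OF V(1)] part[OF V(2)] sep'[OF S(1)] sep'[OF S(2)] S(1) xy(2,3)
      unfolding K1_def K2_def K3_def Diff_iff by satx
  qed
  have vE: "x = v \<and> (y = u \<or> y = w) \<or> y = v \<and> (x = u \<or> x = w)"
    if "{x, y} \<in> E" "x = v \<or> y = v" for x y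
  proof -
    have "z \<in> {u, w}" if "{v, z} \<in> E" for z using that N(1) unfolding nbrs_def by blast
    from this[of x] this[of y] show ?thesis using that by (auto simp: insert_commute)
  qed
  have v1: "K1 x \<Longrightarrow> g x = 4 * f x - 4 * M \<and> 0 < f x \<and> f x < f w \<and> f x < M \<or> g x = 0 \<and> f x = 0" for x
    using gA[of x] gvals fu by (auto simp: K1_def)
  have v2: "K2 x \<Longrightarrow> g x = 4 * f x \<and> 0 < f x \<and> f x < f w \<or> g x = 2 \<and> f x = f w" for x
    using gB[of x] gvals by (auto simp: K2_def)
  have v3: "K3 x \<Longrightarrow> g x = 4 * f x \<and> f w < f x \<or> g x = 0 \<and> f x = 0 \<or> g x = 2 \<and> f x = f w" for x
    using gJ[of x] gvals fu by (auto simp: K3_def)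
  have "noncrossing E g"
    unfolding noncrossing_def
  proof (intro allI impI notI)
    fix a b c d assume e: "{a, c} \<in> E" "{b, d} \<in> E" and gg: "g a < g b \<and> g b < g c \<and> g c < g d"
    have "a \<noteq> v \<and> c \<noteq> v" using vE[OF e(1)] gg gvals by auto
    moreover have "b \<noteq> v \<and> d \<noteq> v" using vE[OF e(2)] gg gvals by auto
    ultimately have k: "K1 a \<and> K1 c \<or> K2 a \<and> K2 c \<or> K3 a \<and> K3 c"
      "K1 b \<and> K1 d \<or> K2 b \<and> K2 d \<or> K3 b \<and> K3 d"
      and S: "{a, c} \<in> suppress E v" "{b, d} \<in> suppress E v"
      using cls[OF e(1)] cls[OF e(2)] by blast+
    note cyc = noncrossing_cyclic[OF nc S]
    show False
      using k(1)
    proof (elim disjE conjE)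
      assume "K1 a" "K1 c"
      note v1[OF \<open>K1 a\<close>] v1[OF \<open>K1 c\<close>]
      with k(2) cyc gg fw v1[of b] v1[of d] v2[of b] v2[of d] v3[of b] v3[of d] show False by smt
    next
      assume "K2 a" "K2 c"
      note v2[OF \<open>K2 a\<close>] v2[OF \<open>K2 c\<close>]
      with k(2) cyc gg fw v1[of b] v1[of d] v2[of b] v2[of d] v3[of b] v3[of d] show False by smt
    next
      assume "K3 a" "K3 c"
      note v3[OF \<open>K3 a\<close>] v3[OF \<open>K3 c\<close>]
      with k(2) cyc gg fw v1[of b] v1[of d] v2[of b] v2[of d] v3[of b] v3[of d] show False by smt
    qed
  qed
  with \<open>inj_on g V\<close> show ?thesis by blast
qed

lemma reach_walk_to:
  assumes x: "x \<in> reach E I u" "{x, w} \<in> E" and "u \<notin> I" "w \<notin> I" "u \<noteq> w"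
  shows "\<exists>xs. xs \<noteq> [] \<and> simple_walk E (u # xs @ [w]) \<and> set xs \<subseteq> I"
proof -
  obtain xs where xs: "simple_walk E (u # xs @ [x])" "set xs \<subseteq> I"
    using walk_of_reach[OF x(1) assms(3)] by blast
  have "x \<in> I" using subsetD[OF reach_subset x(1)] .
  have "simple_walk E (u # (xs @ [x]) @ [w])"
    using xs \<open>x \<in> I\<close> x(2) assms(4,5) path_edges_append[of "u # xs @ [x]" "[w]"]
    by (auto simp: simple_walk_def)
  then show ?thesis using xs(2) \<open>x \<in> I\<close> by (intro exI[of _ "xs @ [x]"]) auto
qed

text \<open>A removed vertex with neighbours \<open>u\<close> and \<open>w\<close> can be put back
  unless the arc from \<open>u\<close> to \<open>w\<close> contains a path between them, and
  likewise for the complementary arc. If both do, these two paths and \<open>[u, v, w]\<close> form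
  an excluded theta.\<close>

theorem outerplanar_imp_noncrossing:
  assumes "finite_simple_graph V E" "outerplanar V E"
  shows "\<exists>f. inj_on f V \<and> noncrossing E f"
  using assms
proof (induction "card V" arbitrary: V E rule: less_induct)
  case less
  note graph = less.prems(1)
  have finV: "finite V" using graph by (simp add: finite_simple_graph_def)
  show ?case
  proof (cases "V = {}")
    case True
    then have "{a, b} \<notin> E" for a b using graph_edgeD[OF graph, of a b] by blast
    then show ?thesis using True by (simp add: noncrossing_def)
  next
    case False
    obtain p c where "plane_embedding V E p c" "p ` V \<subseteq> frontier (outside (drawing V E p c))"
      using less.prems(2) by (auto simp: outerplanar_def)
    then interpret outerplane_graph V E p c using graph by unfold_locales
    obtain v where v: "v \<in> V" "card (nbrs E v) \<le> 2" using ex_vertex_degree_le_2[OF False] by blast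
    have "card (V - {v}) < card V" using finV v(1) by (rule card_Diff1_less)
    then obtain f0 where f0: "inj_on f0 (V - {v})" "noncrossing (suppress E v) f0"
      using less.hyps finite_simple_graph_suppress[OF graph] outerplanar_suppress[OF v(2)] by blast
    show ?thesis
    proof (cases "\<exists>u. nbrs E v \<subseteq> {u}")
      case True
      then obtain u where "nbrs E v \<subseteq> {u}" by blast
      from noncrossing_insert_leaf[OF graph this f0] show ?thesis by blast
    next
      case F: False
      have "finite (nbrs E v)" using finite_nbrs[OF graph] .
      obtain u where u: "u \<in> nbrs E v" using F by blast
      then obtain w where w: "w \<in> nbrs E v" "w \<noteq> u" using F by blast
      have N: "nbrs E v = {u, w}"
        using card_seteq[OF \<open>finite (nbrs E v)\<close>, of "{u, w}"] u w v(2) by auto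
      have uwE: "{v, u} \<in> E" "{v, w} \<in> E" using u w by (auto simp: nbrs_def)
      note uw = graph_edgeD[OF graph uwE(1)] graph_edgeD[OF graph uwE(2)]
      let ?V = "V - {v}" and ?S = "suppress E v"
      have SV: "e \<subseteq> ?V" if "e \<in> ?S" for e
        using that finite_simple_graph_suppress[OF graph, of v] by (auto simp: finite_simple_graph_def)
      define M where "M = 1 + Max (f0 ` ?V) - Min (f0 ` ?V)"
      have M0: "f0 x < f0 y + M" if "x \<in> ?V" "y \<in> ?V" for x y
      proof -
        have "f0 x \<le> Max (f0 ` ?V)" "Min (f0 ` ?V) \<le> f0 y" using that finV by auto
        then show ?thesis unfolding M_def by linarith
      qed
      \<comment> \<open>Rotated so that \<open>u\<close> is at 0 and the arc from \<open>u\<close>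
        to \<open>w\<close> is an interval.\<close>
      define f where "f x = (if f0 x \<ge> f0 u then f0 x - f0 u else f0 x - f0 u + M)" for x
      note f = noncrossing_rotate[OF f0(2) SV f0(1) M0, of "f0 u", folded f_def]
      have fu: "f u = 0" by (simp add: f_def)
      have fpos: "0 < f x" if "x \<in> ?V" "x \<noteq> u" for x
      proof -
        have "u \<in> ?V" using uw by blast
        then have "f0 x \<noteq> f0 u" using that f0(1) by (meson inj_onD)
        then show ?thesis using M0[OF \<open>u \<in> ?V\<close> that(1)] unfolding f_def by auto
      qed
      have fM: "f x < M" if "x \<in> ?V" for x
      proof -
        have "f0 x < f0 u + M" using M0[OF that] uw by blast
        then show ?thesis unfolding f_def by auto
      qed
      have f0le: "0 \<le> f x" if "x \<in> ?V" for x using fpos[OF that] fu by (cases "x = u") auto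
      have M1: "f x < f y + M" if "x \<in> ?V" "y \<in> ?V" for x y
        using fM[OF that(1)] f0le[OF that(2)] by linarith
      \<comment> \<open>Rotated once more so that \<open>w\<close> is at 0, for the complementary
        arc.\<close>
      define f2 where "f2 x = (if f x \<ge> f w then f x - f w else f x - f w + M)" for x
      note f2 = noncrossing_rotate[OF f(2) SV f(1) M1, of "f w", folded f2_def]
      have fw: "0 < f w" "f w < M" using fpos[of w] fM[of w] uw w(2) by auto
      have f2w: "f2 w = 0" and f2u: "f2 u = M - f w" using fu fw by (auto simp: f2_def)
      have f2pos: "0 < f2 x" if "x \<in> ?V" "x \<noteq> w" for x
      proof -
        have "w \<in> ?V" using uw by blast
        then have "f x \<noteq> f w" using that f(1) by (meson inj_onD)
        then show ?thesis using M1[OF \<open>w \<in> ?V\<close> that(1)] unfolding f2_def by auto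
      qed
      define I where "I = {x \<in> ?V. 0 < f x \<and> f x < f w}"
      define J where "J = {x \<in> ?V. 0 < f2 x \<and> f2 x < f2 u}"
      have IJ: "I \<inter> J = {}"
      proof -
        have "f2 u < f2 x" if "x \<in> I" for x using that unfolding f2u by (simp add: I_def f2_def)
        then show ?thesis unfolding J_def by force
      qed
      have uw_notin: "u \<notin> I" "w \<notin> I" "u \<notin> J" "w \<notin> J" "v \<notin> I" "v \<notin> J"
        using fu f2w by (auto simp: I_def J_def)
      show ?thesis
      proof (rule ccontr)
        assume no: "\<not> ?thesis"
        obtain x where "x \<in> reach E I u" "{x, w} \<in> E"
          using noncrossing_insert_between[OF graph N w(2)[symmetric] f fu fpos] no
          unfolding I_def by blast
        then obtain xs where xs: "xs \<noteq> []" "simple_walk E (u # xs @ [w])" "set xs \<subseteq> I"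
          using reach_walk_to uw_notin w(2) by metis
        have N': "nbrs E v = {w, u}" using N by auto
        obtain y where "y \<in> reach E J w" "{y, u} \<in> E"
          using noncrossing_insert_between[OF graph N' w(2) f2 f2w f2pos] no
          unfolding J_def by blast
        then obtain ys where ys: "ys \<noteq> []" "simple_walk E (w # ys @ [u])" "set ys \<subseteq> J"
          using reach_walk_to uw_notin w(2) by metis
        have "simple_walk E (rev (w # ys @ [u]))" using ys(2) by (simp only: simple_walk_rev)
        then have ys': "simple_walk E (u # rev ys @ [w])" by simp
        have vw: "simple_walk E (u # [v] @ [w])"
          using uwE uw w(2) by (auto simp: simple_walk_def insert_commute)
        show False
          by (rule no_theta_subgraph[OF xs(2) ys' vw xs(1)]) (use xs ys IJ uw_notin in auto)
      qed
    qed
  qed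
qed

subsection \<open>Pieces of a noncrossing graph\<close>

text \<open>A piece is a list of edges with the smaller end first, so that the search can be
  evaluated; \<open>remdups\<close> lets lengths count vertices.\<close>

definition adj :: "(nat \<times> nat) list \<Rightarrow> nat \<Rightarrow> nat list" where
  "adj g a = remdups (map snd (filter (\<lambda>e. fst e = a) g) @ map fst (filter (\<lambda>e. snd e = a) g))"

definition second_nbrs :: "(nat \<times> nat) list \<Rightarrow> nat \<Rightarrow> nat list" where
  "second_nbrs g v = filter (\<lambda>w. w \<noteq> v) (remdups (adj g v @ concat (map (adj g) (adj g v))))"

text \<open>Vertex \<open>v\<close> of a piece on the positions \<open>0..n\<close>, whose edges leave it only at \<open>0\<close> and \<open>n\<close>.
  If \<open>v\<close> is adjacent to exactly one end \<open>x\<close>, then at most \<open>D - length (adj g x)\<close> further vertices are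
  reached through \<open>x\<close>, where \<open>D\<close> bounds the degrees; so both bounds give at most \<open>k\<close> vertices whenever
  \<open>s \<le> k\<close> and \<open>D + t \<le> k\<close>.\<close>

definition good_in_piece :: "nat \<Rightarrow> nat \<Rightarrow> nat \<Rightarrow> (nat \<times> nat) list \<Rightarrow> nat \<Rightarrow> bool" where
  "good_in_piece s t n g v \<longleftrightarrow> length (adj g v) \<le> 2 \<and>
    (case filter (\<lambda>x. x = 0 \<or> x = n) (adj g v) of
       [] \<Rightarrow> length (second_nbrs g v) \<le> s
     | [x] \<Rightarrow> length (second_nbrs g v) \<le> length (adj g x) + t
     | _ \<Rightarrow> False)"

definition bad_piece :: "nat \<Rightarrow> nat \<Rightarrow> nat \<Rightarrow> (nat \<times> nat) list \<Rightarrow> bool" where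
  "bad_piece s t n g \<longleftrightarrow> \<not> list_ex (good_in_piece s t n g) [1..<n]"

text \<open>The two pieces share the position \<open>m\<close>. An edge passing over it can only
  join the two outer ends, and \<open>b\<close> tells whether it is present.\<close>

definition glue :: "nat \<Rightarrow> nat \<Rightarrow> (nat \<times> nat) list \<Rightarrow> (nat \<times> nat) list \<Rightarrow> bool \<Rightarrow> (nat \<times> nat) list" where
  "glue m l g h b = g @ map (\<lambda>(x, y). (x + m, y + m)) h @ (if b then [(0, m + l)] else [])"

text \<open>Found by exhaustive search: starting from a single step, glue pieces without a good inner vertex
  and discard the results that have one.\<close>

definition candidates :: "nat \<Rightarrow> (nat \<times> nat) list list" where
  "candidates n =
    (if n = 1 then [[], [(0, 1)]]
     else if n = 2 then [[(0, 1), (0, 2), (1, 2)], [(0, 1), (1, 2)]]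
     else if n = 3 then
       [[(0, 1), (0, 2), (1, 2), (2, 3)],
        [(0, 1), (0, 3), (1, 2), (2, 3)],
        [(0, 1), (1, 2), (1, 3), (2, 3)],
        [(0, 1), (1, 2), (2, 3)]]
     else if n = 4 then
       [[(0, 1), (0, 2), (0, 4), (1, 2), (2, 3), (2, 4), (3, 4)],
        [(0, 1), (0, 2), (0, 4), (1, 2), (2, 3), (3, 4)],
        [(0, 1), (0, 2), (1, 2), (2, 3), (2, 4), (3, 4)],
        [(0, 1), (0, 2), (1, 2), (2, 3), (3, 4)],
        [(0, 1), (0, 4), (1, 2), (2, 3), (2, 4), (3, 4)],
        [(0, 1), (1, 2), (2, 3), (2, 4), (3, 4)]]
     else if n = 5 then
       [[(0, 1), (0, 2), (0, 5), (1, 2), (2, 3), (3, 4), (3, 5), (4, 5)],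
        [(0, 1), (0, 2), (1, 2), (2, 3), (3, 4), (3, 5), (4, 5)]]
     else [])"

text \<open>One table serves both parameter pairs; the filter keeps what is bad for the given
  one.\<close>

definition pieces :: "nat \<Rightarrow> nat \<Rightarrow> nat \<Rightarrow> (nat \<times> nat) list list" where
  "pieces s t n = filter (bad_piece s t n) (candidates n)"

text \<open>Two pieces of at most 5 steps yield at most 10. Where \<open>candidates\<close> is
  empty, the condition says that no bad result arises. Sets are compared since glueing lists the
  edges in another order.\<close>

definition pieces_closed :: "nat \<Rightarrow> nat \<Rightarrow> bool" where
  "pieces_closed s t \<longleftrightarrow>
    list_all (\<lambda>m. list_all (\<lambda>l. list_all (\<lambda>g. list_all (\<lambda>h. list_all (\<lambda>b.
      bad_piece s t (m + l) (glue m l g h b) \<longrightarrow>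
      list_ex (\<lambda>k. set k = set (glue m l g h b)) (candidates (m + l))) [False, True])
      (pieces s t l)) (pieces s t m)) [1..<6]) [1..<6]"

text \<open>The largest \<open>s\<close> and \<open>t\<close> admissible for \<open>D = 5\<close>
  and \<open>k = 6\<close>.\<close>

lemma pieces_closed_6_1: "pieces_closed 6 1"
  by code_simp

text \<open>The largest \<open>s\<close> and \<open>t\<close> admissible for
  \<open>D = k = 7\<close>; they remain admissible for every larger \<open>D = k\<close>.\<close>

lemma pieces_closed_7_0: "pieces_closed 7 0"
  by code_simp

lemma card_image_add_list: "distinct xs \<Longrightarrow> card ((+) i ` set xs) = length xs" for i :: nat
  by (simp add: card_image distinct_card)

section \<open>Intervals of positions that edges leave only at the ends\<close>

locale noncrossing_positions =
  fixes R :: "nat \<Rightarrow> nat \<Rightarrow> bool" and N :: nat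
  assumes sym: "R a b \<Longrightarrow> R b a" and irrefl: "\<not> R a a"
    and bounded: "R a b \<Longrightarrow> a < N"
    and noncross: "R a c \<Longrightarrow> R b d \<Longrightarrow> a < b \<Longrightarrow> b < c \<Longrightarrow> c < d \<Longrightarrow> False"
begin

definition sealed :: "nat \<Rightarrow> nat \<Rightarrow> bool" where
  "sealed i n \<longleftrightarrow> (\<forall>a b. i < a \<longrightarrow> a < i + n \<longrightarrow> R a b \<longrightarrow> i \<le> b \<and> b \<le> i + n)"

definition piece_edges :: "nat \<Rightarrow> nat \<Rightarrow> (nat \<times> nat) set" where
  "piece_edges i n = {(a, b). a < b \<and> b \<le> n \<and> R (i + a) (i + b)}"

definition dist2 :: "nat \<Rightarrow> nat set" where
  "dist2 v = {w. w \<noteq> v \<and> (R v w \<or> (\<exists>u. R v u \<and> R u w))}"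

lemma R_commute: "R a b \<longleftrightarrow> R b a"
  using sym by blast

lemma finite_R: "finite {w. R v w}"
  by (rule finite_subset[of _ "{..<N}"]) (auto dest: bounded[OF sym])

lemma sealedD:
  assumes "sealed i n" "i < a" "a < i + n" "R a b"
  shows "i \<le> b" "b \<le> i + n"
  using assms unfolding sealed_def by blast+

text \<open>Split at the last neighbour of \<open>i\<close> inside the piece.\<close>

lemma sealed_split:
  assumes "sealed i n" "n \<ge> 2"
  obtains m where "0 < m" "m < n" "sealed i m" "sealed (i + m) (n - m)"
proof -
  let ?X = "{a. 0 < a \<and> a < n \<and> R i (i + a)}"
  show thesis
  proof (cases "?X = {}")
    case True
    have "sealed i 1" by (auto simp: sealed_def)
    moreover have "sealed (i + 1) (n - 1)"
      unfolding sealed_def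
    proof (intro allI impI)
      fix a b assume ab: "i + 1 < a" "a < i + 1 + (n - 1)" "R a b"
      have "i \<le> b" "b \<le> i + n" using sealedD[OF assms(1) _ _ ab(3)] ab by auto
      moreover have "b \<noteq> i"
      proof
        assume "b = i"
        then have "a - i \<in> ?X" using ab sym[OF ab(3)] by auto
        then show False using True by blast
      qed
      ultimately show "i + 1 \<le> b \<and> b \<le> i + 1 + (n - 1)" using assms(2) by auto
    qed
    ultimately show thesis using that[of 1] assms(2) by auto
  next
    case False
    have fin: "finite ?X" by simp
    define m where "m = Max ?X"
    have m: "0 < m" "m < n" "R i (i + m)" using Max_in[OF fin False] by (auto simp: m_def)
    have max: "a \<le> m" if "0 < a" "a < n" "R i (i + a)" for a
      using Max_ge[OF fin, of a] that by (simp add: m_def)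
    \<comment> \<open>The edge from \<open>i\<close> to \<open>i + m\<close> shields either part
      from the inner positions of the other; maximality of \<open>m\<close> excludes edges from the
      right part back to \<open>i\<close>.\<close>
    have "sealed i m"
      unfolding sealed_def
    proof (intro allI impI)
      fix a b assume ab: "i < a" "a < i + m" "R a b"
      have "i \<le> b" "b \<le> i + n" using sealedD[OF assms(1) _ _ ab(3)] ab m by auto
      moreover have "\<not> i + m < b" using noncross[OF m(3) ab(3)] ab by blast
      ultimately show "i \<le> b \<and> b \<le> i + m" by auto
    qed
    moreover have "sealed (i + m) (n - m)"
      unfolding sealed_def
    proof (intro allI impI)
      fix a b assume ab: "i + m < a" "a < i + m + (n - m)" "R a b"
      have "i \<le> b" "b \<le> i + n" using sealedD[OF assms(1) _ _ ab(3)] ab m by auto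
      moreover have "b \<noteq> i"
      proof
        assume "b = i"
        then have "R i (i + (a - i))" using ab sym[OF ab(3)] by auto
        moreover have "0 < a - i" "a - i < n" using ab m by linarith+
        ultimately have "a - i \<le> m" using max by blast
        then show False using ab by linarith
      qed
      moreover have "\<not> (i < b \<and> b < i + m)"
        using noncross[OF m(3) sym[OF ab(3)]] ab by blast
      ultimately show "i + m \<le> b \<and> b \<le> i + m + (n - m)" using m by auto
    qed
    ultimately show thesis using that m by blast
  qed
qed

lemma piece_edges_glue:
  assumes "sealed i (m + l)" "sealed i m" "sealed (i + m) l" "0 < m" "0 < l"
    and "set g = piece_edges i m" "set h = piece_edges (i + m) l"
  shows "set (glue m l g h (R i (i + (m + l)))) = piece_edges i (m + l)"
proof -
  have "(a, b) \<in> set (glue m l g h (R i (i + (m + l)))) \<longleftrightarrow> (a, b) \<in> piece_edges i (m + l)" for a b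
  proof -
    have e1: "(a, b) \<in> piece_edges i (m + l) \<longleftrightarrow> (a, b) \<in> piece_edges i m" if "b \<le> m"
      using that by (auto simp: piece_edges_def)
    have e2: "(a, b) \<in> piece_edges i (m + l) \<longleftrightarrow> (a - m, b - m) \<in> piece_edges (i + m) l" if "m \<le> a" "m < b"
      using that by (auto simp: piece_edges_def)
    \<comment> \<open>Such an edge leaves both parts, so neither of its ends is an inner position of
      a part.\<close>
    have e3: "(a, b) \<in> piece_edges i (m + l) \<longleftrightarrow> a = 0 \<and> b = m + l \<and> R i (i + (m + l))" if "a < m" "m < b"
    proof -
      have "\<not> (0 < a \<and> R (i + a) (i + b))" using that sealedD(2)[OF assms(2), of "i + a" "i + b"] by auto
      moreover have "\<not> (b < m + l \<and> R (i + a) (i + b))"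
        using that sealedD(1)[OF assms(3), of "i + b" "i + a"] R_commute[of "i + a" "i + b"] by auto
      ultimately show ?thesis using that by (auto simp: piece_edges_def)
    qed
    have G: "(a, b) \<in> set (glue m l g h (R i (i + (m + l)))) \<longleftrightarrow>
      (a, b) \<in> piece_edges i m \<or> (m \<le> a \<and> m \<le> b \<and> (a - m, b - m) \<in> piece_edges (i + m) l) \<or>
      (a = 0 \<and> b = m + l \<and> R i (i + (m + l)))"
      using assms(6,7) by (force simp: glue_def image_iff)
    consider "b \<le> m" | "m \<le> a" "m < b" | "a < m" "m < b" by linarith
    then show ?thesis
    proof cases
      case 1
      then show ?thesis using G e1[OF 1] assms(4,5) by (auto simp: piece_edges_def)
    next
      case 2
      then show ?thesis using G e2[OF 2] assms(4,5) by (auto simp: piece_edges_def)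
    next
      case 3
      then show ?thesis using G e3[OF 3] assms(4,5) by (auto simp: piece_edges_def)
    qed
  qed
  then show ?thesis by auto
qed

lemma adj_piece:
  assumes "set g = piece_edges i n" "a \<le> n"
  shows "(+) i ` set (adj g a) = {w. R (i + a) w} \<inter> {i..i + n}"
proof -
  have "x \<in> set (adj g a) \<longleftrightarrow> x \<le> n \<and> R (i + a) (i + x)" for x
  proof -
    have "x \<in> set (adj g a) \<longleftrightarrow> (a, x) \<in> set g \<or> (x, a) \<in> set g"
      by (force simp: adj_def image_iff)
    also have "\<dots> \<longleftrightarrow> x \<le> n \<and> R (i + a) (i + x)"
    proof (cases a x rule: linorder_cases)
      case equal
      then show ?thesis using irrefl assms by (simp add: piece_edges_def)
    qed (use assms R_commute[of "i + a" "i + x"] in \<open>auto simp: piece_edges_def\<close>)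
    finally show ?thesis .
  qed
  note * = this
  show ?thesis
  proof
    show "(+) i ` set (adj g a) \<subseteq> {w. R (i + a) w} \<inter> {i..i + n}" using * by auto
    show "{w. R (i + a) w} \<inter> {i..i + n} \<subseteq> (+) i ` set (adj g a)"
    proof
      fix w assume "w \<in> {w. R (i + a) w} \<inter> {i..i + n}"
      then have w: "i \<le> w" "w \<le> i + n" "R (i + a) w" by simp_all
      then have eq: "w = i + (w - i)" and "w - i \<le> n" by linarith+
      then have "w - i \<in> set (adj g a)" using *[of "w - i"] w(3) by simp
      with eq
      show "w \<in> (+) i ` set (adj g a)" by (rule image_eqI)
    qed
  qed
qed

text \<open>Vertices within distance 2 lie in the interval, where \<open>second_nbrs\<close> counts
  them, or are outer neighbours of an adjacent end \<open>x\<close>. On adding both counts the terms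
  \<open>length (adj g x)\<close> cancel.\<close>

lemma good_in_piece_sound:
  assumes g: "set g = piece_edges i n" and sealed: "sealed i n" and v: "0 < v" "v < n"
    and good: "good_in_piece s t n g v"
    and deg: "\<And>a. card {w. R a w} \<le> D" and k: "s \<le> k" "D + t \<le> k"
  shows "card {w. R (i + v) w} \<le> 2 \<and> card (dist2 (i + v)) \<le> k"
proof
  have Rv: "{w. R (i + v) w} = (+) i ` set (adj g v)"
    using adj_piece[OF g, of v] sealedD[OF sealed, of "i + v"] v by auto
  have da: "distinct (adj g a)" for a by (simp add: adj_def)
  show "card {w. R (i + v) w} \<le> 2"
    unfolding Rv using good da by (simp add: card_image_add_list good_in_piece_def)
  let ?S = "(+) i ` set (second_nbrs g v)"
  let ?O = "\<lambda>x. {w. R (i + x) w} - {i..i + n}"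
  have cS: "card ?S = length (second_nbrs g v)"
    by (intro card_image_add_list) (simp add: second_nbrs_def)
  have sub: "dist2 (i + v) \<subseteq> ?S \<union> (\<Union>x\<in>set (filter (\<lambda>x. x = 0 \<or> x = n) (adj g v)). ?O x)"
  proof
    fix w assume "w \<in> dist2 (i + v)"
    then consider "w \<noteq> i + v" "R (i + v) w" | u where "w \<noteq> i + v" "R (i + v) u" "R u w"
      by (auto simp: dist2_def)
    then show "w \<in> ?S \<union> (\<Union>x\<in>set (filter (\<lambda>x. x = 0 \<or> x = n) (adj g v)). ?O x)"
    proof cases
      case 1
      then obtain x where "w = i + x" "x \<in> set (adj g v)" using Rv by blast
      then show ?thesis using 1 by (auto simp: second_nbrs_def)
    next
      case 2
      then obtain x where x: "u = i + x" "x \<in> set (adj g v)" using Rv by blast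
      have "u \<in> (+) i ` set (adj g v)" using x by blast
      then have xn: "x \<le> n" using adj_piece[OF g, of v] v x(1) by auto
      show ?thesis
      proof (cases "w \<in> {i..i + n}")
        case True
        then have "w \<in> (+) i ` set (adj g x)" using adj_piece[OF g xn] 2 x by blast
        then show ?thesis using 2 x by (auto simp: second_nbrs_def)
      next
        case False
        have "x = 0 \<or> x = n"
        proof (rule ccontr)
          assume "\<not> (x = 0 \<or> x = n)"
          then show False using sealedD[OF sealed _ _ 2(3)] False xn x(1) by auto
        qed
        then show ?thesis using False 2 x by auto
      qed
    qed
  qed
  have O: "card (?O x) + length (adj g x) \<le> D" if "x \<le> n" for x
  proof -
    have "card (?O x \<union> ({w. R (i + x) w} \<inter> {i..i + n})) =
        card (?O x) + card ({w. R (i + x) w} \<inter> {i..i + n})"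
      using finite_R[of "i + x"] by (intro card_Un_disjoint) auto
    moreover have "?O x \<union> ({w. R (i + x) w} \<inter> {i..i + n}) = {w. R (i + x) w}" by blast
    ultimately have "card (?O x) + card ({w. R (i + x) w} \<inter> {i..i + n}) = card {w. R (i + x) w}"
      by simp
    then show ?thesis
      using deg[of "i + x"] adj_piece[OF g that] card_image_add_list[OF da, of i x] by simp
  qed
  have finS: "finite ?S" by simp
  show "card (dist2 (i + v)) \<le> k"
  proof (cases "filter (\<lambda>x. x = 0 \<or> x = n) (adj g v)")
    case Nil
    then have "dist2 (i + v) \<subseteq> ?S" using sub by auto
    then have "card (dist2 (i + v)) \<le> card ?S" using finS by (intro card_mono)
    also have "\<dots> \<le> s" unfolding cS using good Nil by (simp add: good_in_piece_def)
    finally show ?thesis using k by simp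
  next
    case (Cons x xs)
    then have xs: "xs = []" using good by (auto simp: good_in_piece_def split: list.splits)
    have "x \<in> set (filter (\<lambda>x. x = 0 \<or> x = n) (adj g v))" unfolding Cons by simp
    then have xn: "x \<le> n" by auto
    have "dist2 (i + v) \<subseteq> ?S \<union> ?O x" using sub unfolding Cons xs by simp
    then have "card (dist2 (i + v)) \<le> card (?S \<union> ?O x)"
      using finS finite_R by (intro card_mono) auto
    also have "\<dots> \<le> card ?S + card (?O x)" by (rule card_Un_le)
    also have "card ?S \<le> length (adj g x) + t"
      unfolding cS using good Cons xs by (simp add: good_in_piece_def)
    finally show ?thesis using O[OF xn] k by linarith
  qed
qed

text \<open>A sealed interval splits into two shorter ones, which are in the table by induction.
  Their glueing has no good inner vertex either, so closure puts it into the table.\<close>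

lemma bad_interval_pieces:
  assumes closed: "pieces_closed s t"
    and deg: "\<And>a. card {w. R a w} \<le> D" and k: "s \<le> k" "D + t \<le> k"
    and bad: "\<And>v. v < N \<Longrightarrow> card {w. R v w} \<le> 2 \<Longrightarrow> k < card (dist2 v)"
    and "sealed i n" "0 < n" "i + n < N"
  shows "\<exists>g\<in>set (pieces s t n). set g = piece_edges i n"
  using assms(6-8)
proof (induction n arbitrary: i rule: less_induct)
  case (less n)
  have bp: "bad_piece s t n g" if g: "set g = piece_edges i n" for g
    unfolding bad_piece_def list_ex_iff
  proof
    assume "\<exists>v\<in>set [1..<n]. good_in_piece s t n g v"
    then obtain v where v: "0 < v" "v < n" "good_in_piece s t n g v"
      by (auto simp: Suc_le_eq)
    show False
      using good_in_piece_sound[OF g less.prems(1) v deg k] bad[of "i + v"] v less.prems(3) by auto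
  qed
  have suff: "?case" if "set g = piece_edges i n" "\<exists>k\<in>set (candidates n). set k = set g" for g
    using that bp by (auto simp: pieces_def)
  show ?case
  proof (cases "n = 1")
    case True
    have "piece_edges i 1 = (if R i (i + 1) then {(0, 1)} else {})"
    proof -
      have "a < b \<and> b \<le> 1 \<longleftrightarrow> a = 0 \<and> b = 1" for a b :: nat by auto
      then have "a < b \<and> b \<le> 1 \<and> R (i + a) (i + b) \<longleftrightarrow> a = 0 \<and> b = 1 \<and> R i (i + 1)" for a b
        by (metis add_0_right)
      then show ?thesis unfolding piece_edges_def by auto
    qed
    then show ?thesis
      using True by (intro suff[of "if R i (i + 1) then [(0, 1)] else []"]) (auto simp: candidates_def)
  next
    case False
    then have "n \<ge> 2" using less.prems by simp
    then obtain m where m: "0 < m" "m < n" "sealed i m" "sealed (i + m) (n - m)"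
      using sealed_split[OF less.prems(1)] by blast
    define l where "l = n - m"
    have n: "n = m + l" "0 < l" using m by (auto simp: l_def)
    obtain g where g: "g \<in> set (pieces s t m)" "set g = piece_edges i m"
      using less.IH[OF m(2,3,1)] m(2) less.prems(3) by auto
    obtain h where h: "h \<in> set (pieces s t l)" "set h = piece_edges (i + m) l"
      using less.IH[of l "i + m"] m less.prems(3) by (auto simp: l_def)
    have ml: "m \<in> set [1..<6]" "l \<in> set [1..<6]"
      using g(1) h(1) m(1) n(2) by (auto simp: pieces_def candidates_def split: if_splits)
    let ?b = "R i (i + (m + l))"
    let ?c = "glue m l g h ?b"
    have c: "set ?c = piece_edges i n"
      using piece_edges_glue[of i m l g h] less.prems(1) m n g h unfolding n(1) l_def[symmetric] by auto
    have "?b \<in> set [False, True]" by auto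
    with closed ml g(1) h(1) have "bad_piece s t (m + l) ?c \<longrightarrow>
        (\<exists>k\<in>set (candidates (m + l)). set k = set ?c)"
      unfolding pieces_closed_def list_all_iff list_ex_iff by blast
    then show ?thesis using suff[OF c] bp[OF c] n by auto
  qed
qed

theorem ex_good_position:
  assumes "pieces_closed s t"
    and deg: "\<And>a. card {w. R a w} \<le> D" and k: "s \<le> k" "D + t \<le> k" and N: "N \<ge> 7"
  shows "\<exists>v<N. card {w. R v w} \<le> 2 \<and> card (dist2 v) \<le> k"
proof (rule ccontr)
  assume no: "\<not> ?thesis"
  then have "k < card (dist2 v)" if "v < N" "card {w. R v w} \<le> 2" for v
    using that by force
  \<comment> \<open>All edges stay among the \<open>N\<close> positions, and \<open>N - 1\<close> is
    at least 6, beyond the lengths in the table.\<close>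
  moreover have "sealed 0 (N - 1)"
    unfolding sealed_def using bounded[OF sym] by (auto simp: le_diff_conv2 Suc_le_eq less_imp_le)
  ultimately obtain g where "g \<in> set (pieces s t (N - 1))"
    using bad_interval_pieces[OF assms(1) deg k, of 0 "N - 1"] N by auto
  then show False using N by (auto simp: pieces_def candidates_def split: if_splits)
qed

end

subsection \<open>The square of a noncrossing graph\<close>

text \<open>The neighbourhood of \<open>v\<close> in the square, expressed by edges instead of
  distances so that suppression is easy to follow.\<close>

definition ball2 :: "'a set set \<Rightarrow> 'a \<Rightarrow> 'a set" where
  "ball2 E v = {w. w \<noteq> v \<and> ({v, w} \<in> E \<or> (\<exists>u. {v, u} \<in> E \<and> {u, w} \<in> E))}"

lemma ball2_subset: "finite_simple_graph V E \<Longrightarrow> ball2 E v \<subseteq> V - {v}"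
  using graph_edgeD(2)[of V E] by (auto simp: ball2_def)

text \<open>Only the order of the values of \<open>f\<close> matters: \<open>h\<close> lists the
  vertices by increasing value and carries the statement about positions over to the graph.\<close>

lemma ex_good_vertex:
  assumes graph: "finite_simple_graph V E" and f: "inj_on f V" "noncrossing E f"
    and closed: "pieces_closed s t"
    and deg: "\<And>v. card (nbrs E v) \<le> D" and k: "s \<le> k" "D + t \<le> k" and V: "card V \<ge> 7"
  shows "\<exists>v\<in>V. card (nbrs E v) \<le> 2 \<and> card (ball2 E v) \<le> k"
proof -
  have finV: "finite V" using graph by (simp add: finite_simple_graph_def)
  define N where "N = card V"
  define xs where "xs = sorted_list_of_set (f ` V)"
  define h where "h j = inv_into V f (xs ! j)" for j
  have len: "length xs = N" using f(1) by (simp add: xs_def N_def card_image)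
  have setxs: "set xs = f ` V" using finV by (simp add: xs_def)
  have hV: "h j \<in> V" and fh: "f (h j) = xs ! j" if "j < N" for j
    using that len setxs nth_mem[of j xs] by (auto simp: h_def inv_into_into f_inv_into_f)
  have mono: "f (h a) < f (h b)" if "a < b" "b < N" for a b
  proof -
    have "sorted_wrt (<) xs" by (simp add: xs_def)
    then show ?thesis using that len fh by (simp add: sorted_wrt_iff_nth_less)
  qed
  have hinj: "inj_on h {..<N}"
  proof (rule inj_onI)
    fix a b assume "a \<in> {..<N}" "b \<in> {..<N}" "h a = h b"
    then show "a = b" using mono[of a b] mono[of b a] by (cases a b rule: linorder_cases) auto
  qed
  have hsurj: "\<exists>j<N. h j = x" if "x \<in> V" for x
  proof -
    have "f x \<in> set xs" using that setxs by blast
    then obtain j where "j < N" "xs ! j = f x" using len by (auto simp: in_set_conv_nth)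
    then show ?thesis using that f(1) by (intro exI[of _ j]) (simp add: h_def inv_into_f_f)
  qed
  define R where "R a b \<longleftrightarrow> a < N \<and> b < N \<and> {h a, h b} \<in> E" for a b
  interpret noncrossing_positions R N
  proof
    show "R a b \<Longrightarrow> R b a" for a b by (simp add: R_def insert_commute)
    show "\<not> R a a" for a using graph_edgeD(3)[OF graph, of "h a" "h a"] by (auto simp: R_def)
    show "R a b \<Longrightarrow> a < N" for a b by (simp add: R_def)
    show False if "R a c" "R b d" "a < b" "b < c" "c < d" for a b c d
      using noncrossingD[OF f(2), of "h a" "h c" "h b" "h d"] mono[of a b] mono[of b c] mono[of c d] that
      by (simp add: R_def)
  qed
  have nb: "nbrs E (h a) = h ` {b. R a b}" if "a < N" for a
  proof
    show "nbrs E (h a) \<subseteq> h ` {b. R a b}"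
    proof
      fix x assume x: "x \<in> nbrs E (h a)"
      then have "x \<in> V" using nbrs_subset[OF graph] by blast
      then obtain j where "j < N" "h j = x" using hsurj by blast
      then show "x \<in> h ` {b. R a b}" using x that by (auto simp: R_def nbrs_def)
    qed
    show "h ` {b. R a b} \<subseteq> nbrs E (h a)" by (auto simp: R_def nbrs_def)
  qed
  have Rsub: "{b. R a b} \<subseteq> {..<N}" for a by (auto simp: R_def)
  have cnb: "card (nbrs E (h a)) = card {b. R a b}" if "a < N" for a
    unfolding nb[OF that] by (rule card_image) (rule inj_on_subset[OF hinj Rsub])
  have "card {w. R a w} \<le> D" for a
  proof (cases "a < N")
    case True
    then show ?thesis using cnb[OF True] deg[of "h a"] by simp
  next
    case False
    then have "{w. R a w} = {}" by (simp add: R_def)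
    then show ?thesis by simp
  qed
  from ex_good_position[OF closed this k] V obtain j where
    j: "j < N" "card {w. R j w} \<le> 2" "card (dist2 j) \<le> k" by (auto simp: N_def)
  have "ball2 E (h j) \<subseteq> h ` dist2 j"
  proof
    fix x assume x: "x \<in> ball2 E (h j)"
    then have "x \<in> V" using ball2_subset[OF graph] by blast
    then obtain i where i: "i < N" "h i = x" using hsurj by blast
    have "i \<noteq> j" using x i by (auto simp: ball2_def)
    moreover have "R j i \<or> (\<exists>u. R j u \<and> R u i)"
    proof (cases "{h j, x} \<in> E")
      case True
      then show ?thesis using i j by (simp add: R_def)
    next
      case False
      then obtain y where y: "{h j, y} \<in> E" "{y, x} \<in> E" using x by (auto simp: ball2_def)
      obtain u where "u < N" "h u = y" using hsurj graph_edgeD(2)[OF graph y(1)] by blast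
      then show ?thesis using i j y by (auto simp: R_def)
    qed
    ultimately have "i \<in> dist2 j" by (simp add: dist2_def)
    then show "x \<in> h ` dist2 j" using i by blast
  qed
  moreover have fd: "finite (dist2 j)"
    by (rule finite_subset[of _ "{..<N}"]) (auto simp: dist2_def R_def)
  ultimately have "card (ball2 E (h j)) \<le> card (dist2 j)"
    by (meson card_image_le card_mono finite_imageI le_trans)
  then have "card (nbrs E (h j)) \<le> 2 \<and> card (ball2 E (h j)) \<le> k" using j cnb[OF j(1)] by simp
  then show ?thesis using hV[OF j(1)] by blast
qed

text \<open>A joined pair stands for the path through \<open>v\<close>. An old edge crossing it
  separates the two neighbours, so wherever \<open>v\<close> lies, it crosses an edge at
  \<open>v\<close>. Two joined pairs that cross would give \<open>v\<close> more than two
  neighbours.\<close>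

lemma noncrossing_suppress:
  assumes graph: "finite_simple_graph V E" and f: "inj_on f V" "noncrossing E f"
    and deg: "card (nbrs E v) \<le> 2"
  shows "noncrossing (suppress E v) f"
  unfolding noncrossing_def
proof (intro allI impI notI)
  fix a b c d
  assume e: "{a, c} \<in> suppress E v" "{b, d} \<in> suppress E v"
    and lt: "f a < f b \<and> f b < f c \<and> f c < f d"
  have cases: "{x, y} \<in> E \<and> x \<noteq> v \<and> y \<noteq> v \<or> {v, x} \<in> E \<and> {v, y} \<in> E" if "{x, y} \<in> suppress E v" for x y
    using that by (auto simp: suppress_def doubleton_eq_iff)
  have ne: "f x \<noteq> f y" if "x \<noteq> y" "x \<in> V" "y \<in> V" for x y using f(1) that by (meson inj_onD)
  have V: "a \<in> V" "b \<in> V" "c \<in> V" "d \<in> V"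
    using graph_edgeD[OF finite_simple_graph_suppress[OF graph] e(1)]
      graph_edgeD[OF finite_simple_graph_suppress[OF graph] e(2)] by auto
  consider "{a, c} \<in> E" "{b, d} \<in> E" | "{v, a} \<in> E" "{v, c} \<in> E" "{b, d} \<in> E" "b \<noteq> v" "d \<noteq> v"
    | "{a, c} \<in> E" "a \<noteq> v" "c \<noteq> v" "{v, b} \<in> E" "{v, d} \<in> E"
    | "{v, a} \<in> E" "{v, c} \<in> E" "{v, b} \<in> E" "{v, d} \<in> E"
    using cases[OF e(1)] cases[OF e(2)] by blast
  then show False
  proof cases
    case 1
    then show False using noncrossingD[OF f(2) 1] lt by blast
  next
    case 2
    have vV: "v \<in> V" using graph_edgeD[OF graph 2(1)] by blast
    have "f v \<noteq> f b" "f v \<noteq> f d" using ne 2 V vV by metis+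
    moreover have "{d, b} \<in> E" using 2(3) by (simp add: insert_commute)
    ultimately show False
      using noncrossing_cyclic[OF f(2) 2(1)] noncrossing_cyclic[OF f(2) 2(2,3)] lt by (metis linorder_neqE)
  next
    case 3
    have vV: "v \<in> V" using graph_edgeD[OF graph 3(4)] by blast
    have "f v \<noteq> f a" "f v \<noteq> f c" using ne 3 V vV by metis+
    moreover have "{b, v} \<in> E" using 3(4) by (simp add: insert_commute)
    ultimately show False
      using noncrossing_cyclic[OF f(2) 3(1)] noncrossing_cyclic[OF f(2) 3(1,5)] lt by (metis linorder_neqE)
  next
    case 4
    have "{a, b, c} \<subseteq> nbrs E v" using 4 by (auto simp: nbrs_def)
    then have "card {a, b, c} \<le> 2" using deg finite_nbrs[OF graph] by (meson card_mono le_trans)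
    moreover have "a \<noteq> b" "b \<noteq> c" "a \<noteq> c" using lt by auto
    ultimately show False by simp
  qed
qed

text \<open>A neighbour of \<open>v\<close> loses \<open>v\<close> and gains at most the other
  neighbour of \<open>v\<close>.\<close>

lemma card_nbrs_suppress:
  assumes graph: "finite_simple_graph V E" and deg: "card (nbrs E v) \<le> 2"
  shows "card (nbrs (suppress E v) x) \<le> card (nbrs E x)"
proof (cases "v \<in> nbrs E x")
  case False
  have "nbrs (suppress E v) x \<subseteq> nbrs E x"
  proof
    fix y assume "y \<in> nbrs (suppress E v) x"
    then have "{x, y} \<in> E \<or> {v, x} \<in> E \<and> {v, y} \<in> E"
      by (auto simp: nbrs_def suppress_def doubleton_eq_iff)
    then show "y \<in> nbrs E x" using False by (auto simp: nbrs_def insert_commute)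
  qed
  then show ?thesis by (intro card_mono finite_nbrs[OF graph])
next
  case True
  have x: "x \<in> nbrs E v" using True nbrs_commute by metis
  have "nbrs (suppress E v) x \<subseteq> (nbrs E x - {v}) \<union> (nbrs E v - {x})"
  proof
    fix y assume y: "y \<in> nbrs (suppress E v) x"
    then have "{x, y} \<in> E \<and> y \<noteq> v \<or> y \<noteq> x \<and> {v, y} \<in> E"
      by (auto simp: nbrs_def suppress_def doubleton_eq_iff)
    then show "y \<in> (nbrs E x - {v}) \<union> (nbrs E v - {x})" by (auto simp: nbrs_def)
  qed
  then have "card (nbrs (suppress E v) x) \<le> card ((nbrs E x - {v}) \<union> (nbrs E v - {x}))"
    by (intro card_mono) (simp_all add: finite_nbrs[OF graph])
  also have "\<dots> \<le> card (nbrs E x - {v}) + card (nbrs E v - {x})" by (rule card_Un_le)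
  also have "\<dots> = card (nbrs E x) - 1 + (card (nbrs E v) - 1)"
    using True x finite_nbrs[OF graph] by (simp add: card_Diff_singleton)
  also have "\<dots> \<le> card (nbrs E x)"
  proof -
    have "card (nbrs E x) > 0" using True finite_nbrs[OF graph] by (metis card_gt_0_iff empty_iff)
    then show ?thesis using deg by linarith
  qed
  finally show ?thesis .
qed

text \<open>A path of length 2 through \<open>v\<close> becomes an edge; shorter or other paths
  avoid \<open>v\<close> and survive.\<close>

lemma ball2_suppress:
  assumes "x \<noteq> v"
  shows "ball2 E x - {v} \<subseteq> ball2 (suppress E v) x"
proof
  fix y assume y: "y \<in> ball2 E x - {v}"
  then consider "{x, y} \<in> E" | u where "{x, u} \<in> E" "{u, y} \<in> E" by (auto simp: ball2_def)
  then show "y \<in> ball2 (suppress E v) x"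
  proof cases
    case 1
    then show ?thesis using y assms by (auto simp: ball2_def suppress_def)
  next
    case 2
    show ?thesis
    proof (cases "u = v")
      case True
      then have "{v, x} \<in> E" "{v, y} \<in> E" using 2 by (auto simp: insert_commute)
      then have "{x, y} \<in> suppress E v" using y by (auto simp: suppress_def ball2_def)
      then show ?thesis using y by (auto simp: ball2_def)
    next
      case False
      then have "{x, u} \<in> suppress E v" "{u, y} \<in> suppress E v"
        using 2 y assms by (auto simp: suppress_def)
      then show ?thesis using y by (auto simp: ball2_def)
    qed
  qed
qed

lemma square_degenerate:
  assumes "finite_simple_graph V E" "inj_on f V" "noncrossing E f"
    and closed: "pieces_closed s t"
    and "\<And>v. card (nbrs E v) \<le> D" and k: "s \<le> k" "D + t \<le> k" "5 \<le> k"
    and "S \<subseteq> V" "S \<noteq> {}"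
  shows "\<exists>v\<in>S. card (ball2 E v \<inter> S) \<le> k"
  using assms(1-3,5,9,10)
proof (induction "card V" arbitrary: V E rule: less_induct)
  case less
  note graph = less.prems(1)
  have finV: "finite V" using graph by (simp add: finite_simple_graph_def)
  show ?case
  proof (cases "card V \<ge> 7")
    \<comment> \<open>At most six vertices leave at most five others, whence the condition
      \<open>5 \<le> k\<close>.\<close>
    case False
    obtain v where v: "v \<in> S" using less.prems by blast
    have "ball2 E v \<inter> S \<subseteq> V - {v}" using ball2_subset[OF graph] by blast
    then have "card (ball2 E v \<inter> S) \<le> card (V - {v})" using finV by (intro card_mono) auto
    also have "\<dots> \<le> 5" using False v less.prems(5) by (subst card_Diff_singleton) auto
    finally show ?thesis using v k by (meson le_trans)
  next
    case True
    obtain v where v: "v \<in> V" "card (nbrs E v) \<le> 2" "card (ball2 E v) \<le> k"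
      using ex_good_vertex[OF less.prems(1-3) closed less.prems(4) k(1,2) True] by blast
    show ?thesis
    proof (cases "v \<in> S")
      case True
      have "finite (ball2 E v)"
        using ball2_subset[OF graph] finV finite_subset by (metis finite_Diff)
      then have "card (ball2 E v \<inter> S) \<le> card (ball2 E v)" by (intro card_mono) auto
      then show ?thesis using True v by (meson le_trans)
    next
      case False
      have "\<exists>w\<in>S. card (ball2 (suppress E v) w \<inter> S) \<le> k"
      proof (rule less.hyps)
        show "card (V - {v}) < card V" using finV v(1) by (rule card_Diff1_less)
        show "finite_simple_graph (V - {v}) (suppress E v)"
          by (rule finite_simple_graph_suppress[OF graph])
        show "inj_on f (V - {v})" using less.prems(2) by (rule inj_on_subset) blast
        show "noncrossing (suppress E v) f"
          by (rule noncrossing_suppress[OF less.prems(1-3) v(2)])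
        show "card (nbrs (suppress E v) x) \<le> D" for x
          using card_nbrs_suppress[OF graph v(2)] less.prems(4) le_trans by blast
        show "S \<subseteq> V - {v}" "S \<noteq> {}" using less.prems False by auto
      qed
      then obtain w where w: "w \<in> S" "card (ball2 (suppress E v) w \<inter> S) \<le> k" by blast
      have "w \<noteq> v" using w False by blast
      then have "ball2 E w \<inter> S \<subseteq> ball2 (suppress E v) w \<inter> S"
        using ball2_suppress[of w v E] False by blast
      moreover have "finite S" using less.prems finV finite_subset by blast
      ultimately have "card (ball2 E w \<inter> S) \<le> card (ball2 (suppress E v) w \<inter> S)"
        by (intro card_mono) auto
      then show ?thesis using w by (meson le_trans)
    qed
  qed
qed

section \<open>Degrees and distances in the square\<close>

lemma vdegree_eq_card_nbrs:
  assumes "\<And>e. e \<in> H \<Longrightarrow> card e = 2"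
  shows "vdegree H v = card (nbrs H v)"
proof -
  have "{e \<in> H. v \<in> e} = (\<lambda>w. {v, w}) ` nbrs H v"
  proof
    show "{e \<in> H. v \<in> e} \<subseteq> (\<lambda>w. {v, w}) ` nbrs H v"
    proof
      fix e assume e: "e \<in> {e \<in> H. v \<in> e}"
      then have "card e = 2" using assms by blast
      then obtain x y where "e = {x, y}" by (auto simp: card_2_iff)
      then have "e = {v, x} \<or> e = {v, y}" using e by auto
      then show "e \<in> (\<lambda>w. {v, w}) ` nbrs H v" using e by (auto simp: nbrs_def)
    qed
  qed (auto simp: nbrs_def)
  moreover have "inj_on (\<lambda>w. {v, w}) (nbrs H v)"
    by (auto simp: inj_on_def doubleton_eq_iff)
  ultimately show ?thesis by (simp add: vdegree_def card_image)
qed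

text \<open>The extended naturals are well-ordered, so an infimum over walks is attained; without
  walks it would be \<infinity>.\<close>

lemma gdist_eq_enatD:
  assumes "gdist V E u v = enat n"
  shows "\<exists>xs. walk_betw V E u xs v \<and> length xs - 1 = n"
proof -
  let ?W = "{xs. walk_betw V E u xs v}"
  let ?L = "(\<lambda>xs. enat (length xs - 1)) ` ?W"
  have "?L \<noteq> {}"
  proof
    assume "?L = {}"
    then have "gdist V E u v = \<infinity>" unfolding gdist_def by (simp add: Inf_enat_def)
    then show False using assms by simp
  qed
  then have "Inf ?L \<in> ?L" unfolding Inf_enat_def by (metis (mono_tags) LeastI ex_in_conv)
  then show ?thesis using assms by (auto simp: gdist_def)
qed

lemma gdist_le: "walk_betw V E u xs v \<Longrightarrow> gdist V E u v \<le> enat (length xs - 1)"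
  unfolding gdist_def by (rule INF_lower) simp

lemma gdist_ge_1:
  assumes "u \<noteq> v"
  shows "1 \<le> gdist V E u v"
  unfolding gdist_def
proof (rule INF_greatest)
  fix xs assume "xs \<in> {xs. walk_betw V E u xs v}"
  then have xs: "xs \<noteq> []" "hd xs = u" "last xs = v" by (auto simp: walk_betw_def)
  from xs(1) obtain y ys where ys: "xs = y # ys" by (cases xs) auto
  then have "ys \<noteq> []" using xs assms by auto
  then have "1 \<le> length xs - 1" using ys by (cases ys) auto
  then show "1 \<le> enat (length xs - 1)" by (simp add: one_enat_def)
qed

text \<open>A walk of length 1 or 2 has the form \<open>[a, b]\<close> or \<open>[a, b, c]\<close>.
  Conversely such a walk bounds the distance by 2, and distinct ends bound it below by 1.\<close>

lemma square_edge_iff: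
  assumes graph: "finite_simple_graph V E"
  shows "{u, v} \<in> square_edges V E \<longleftrightarrow> v \<in> ball2 E u"
proof
  assume "{u, v} \<in> square_edges V E"
  then obtain x y where xy: "{u, v} = {x, y}" "x \<noteq> y" "gdist V E x y = 1 \<or> gdist V E x y = 2"
    by (auto simp: square_edges_def)
  have "y \<in> ball2 E x"
    using xy(3)
  proof
    assume "gdist V E x y = 1"
    then obtain xs where xs: "walk_betw V E x xs y" "length xs - 1 = 1"
      using gdist_eq_enatD[of V E x y 1] by (auto simp: one_enat_def)
    then have "length xs = 2" by simp
    then obtain a b where "xs = [a, b]" by (auto simp: length_Suc_conv numeral_2_eq_2)
    then show ?thesis using xs xy(2) by (auto simp: walk_betw_def ball2_def)
  next
    assume "gdist V E x y = 2"
    then obtain xs where xs: "walk_betw V E x xs y" "length xs - 1 = 2"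
      using gdist_eq_enatD[of V E x y 2] by (auto simp: numeral_eq_enat)
    then have "length xs = 3" by simp
    then obtain a b c where "xs = [a, b, c]" by (auto simp: length_Suc_conv numeral_3_eq_3)
    then show ?thesis using xs xy(2) by (auto simp: walk_betw_def ball2_def)
  qed
  then have "x \<in> ball2 E y" by (auto simp: ball2_def insert_commute)
  with \<open>y \<in> ball2 E x\<close> show "v \<in> ball2 E u" using xy(1) by (auto simp: doubleton_eq_iff)
next
  assume v: "v \<in> ball2 E u"
  then have "u \<noteq> v" by (auto simp: ball2_def)
  obtain xs where xs: "walk_betw V E u xs v" "length xs - 1 \<le> 2"
  proof (cases "{u, v} \<in> E")
    case True
    then have "walk_betw V E u [u, v] v" using graph_edgeD[OF graph] by (simp add: walk_betw_def)
    then show thesis using that by force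
  next
    case False
    then obtain w where w: "{u, w} \<in> E" "{w, v} \<in> E" using v by (auto simp: ball2_def)
    then have "walk_betw V E u [u, w, v] v" using graph_edgeD[OF graph] by (simp add: walk_betw_def)
    then show thesis using that by force
  qed
  have "gdist V E u v \<le> enat (length xs - 1)" by (rule gdist_le[OF xs(1)])
  also have "\<dots> \<le> enat 2" using xs(2) by simp
  finally obtain n where n: "gdist V E u v = enat n" "n \<le> 2"
    by (cases "gdist V E u v") auto
  moreover have "1 \<le> n" using gdist_ge_1[OF \<open>u \<noteq> v\<close>, of V E] n(1) by (simp add: one_enat_def)
  ultimately have "gdist V E u v = 1 \<or> gdist V E u v = 2"
    by (auto simp: one_enat_def numeral_eq_enat le_Suc_eq numeral_2_eq_2)
  moreover have "u \<in> V" "v \<in> V"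
    using v graph_edgeD[OF graph] ball2_subset[OF graph] by (auto simp: ball2_def)
  ultimately show "{u, v} \<in> square_edges V E" using \<open>u \<noteq> v\<close> by (auto simp: square_edges_def)
qed

lemma vdegree_induced_square:
  assumes graph: "finite_simple_graph V E" and "v \<in> S"
  shows "vdegree (induced_edges (square_edges V E) S) v = card (ball2 E v \<inter> S)"
proof -
  have "card e = 2" if "e \<in> induced_edges (square_edges V E) S" for e
    using that by (auto simp: induced_edges_def square_edges_def)
  then have "vdegree (induced_edges (square_edges V E) S) v =
      card (nbrs (induced_edges (square_edges V E) S) v)"
    by (rule vdegree_eq_card_nbrs)
  also have "nbrs (induced_edges (square_edges V E) S) v = ball2 E v \<inter> S"
    using assms(2) square_edge_iff[OF graph] by (auto simp: nbrs_def induced_edges_def)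
  finally show ?thesis .
qed

section \<open>Bounds for the inductiveness and the conclusion\<close>

lemma inductiveness_le:
  assumes "finite V" "V \<noteq> {}"
    and "\<And>S. S \<subseteq> V \<Longrightarrow> S \<noteq> {} \<Longrightarrow> \<exists>v\<in>S. vdegree (induced_edges H S) v \<le> k"
  shows "inductiveness V H \<le> k"
proof -
  let ?M = "{min_degree S (induced_edges H S) | S. S \<subseteq> V \<and> S \<noteq> {}}"
  have M: "?M = (\<lambda>S. min_degree S (induced_edges H S)) ` {S. S \<subseteq> V \<and> S \<noteq> {}}" by auto
  have "finite ?M" unfolding M using assms(1) by simp
  moreover have "?M \<noteq> {}" using assms(2) by blast
  moreover have "m \<le> k" if m: "m \<in> ?M" for m
  proof -
    obtain S where S: "m = min_degree S (induced_edges H S)" "S \<subseteq> V" "S \<noteq> {}" using m by blast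
    obtain v where v: "v \<in> S" "vdegree (induced_edges H S) v \<le> k" using assms(3)[OF S(2,3)] by blast
    have "finite S" using S(2) assms(1) by (rule finite_subset)
    then have "m \<le> vdegree (induced_edges H S) v"
      unfolding S(1) min_degree_def using v(1) by (intro Min_le) auto
    then show ?thesis using v(2) by simp
  qed
  ultimately show ?thesis unfolding inductiveness_def by simp
qed

lemma inductiveness_ge:
  assumes "finite V" "S \<subseteq> V" "S \<noteq> {}" "\<And>v. v \<in> S \<Longrightarrow> k \<le> vdegree (induced_edges H S) v"
  shows "k \<le> inductiveness V H"
proof -
  let ?M = "{min_degree S (induced_edges H S) | S. S \<subseteq> V \<and> S \<noteq> {}}"
  have M: "?M = (\<lambda>S. min_degree S (induced_edges H S)) ` {S. S \<subseteq> V \<and> S \<noteq> {}}" by auto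
  have "finite S" using assms(2,1) by (rule finite_subset)
  then have "k \<le> min_degree S (induced_edges H S)"
    unfolding min_degree_def using assms(3,4) by simp
  also have "\<dots> \<le> Max ?M"
  proof (rule Max_ge)
    show "finite ?M" unfolding M using assms(1) by simp
    show "min_degree S (induced_edges H S) \<in> ?M" using assms by blast
  qed
  finally show ?thesis unfolding inductiveness_def .
qed

theorem theorem3p1:
  fixes V :: "'a set" and E :: "'a set set" and \<Delta> :: nat
  assumes "finite_simple_graph V E"
    and "outerplanar V E"
    and "max_degree V E = \<Delta>"
    and "\<Delta> \<ge> 5"
  shows "inductiveness V (square_edges V E) \<le> \<Delta> + 1
    \<and> (\<Delta> \<ge> 7 \<longrightarrow> inductiveness V (square_edges V E) = \<Delta>)"
proof -
  note graph = assms(1)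
  have finV: "finite V" using graph by (simp add: finite_simple_graph_def)
  have vd: "vdegree E v = card (nbrs E v)" for v
    using graph by (intro vdegree_eq_card_nbrs) (auto simp: finite_simple_graph_def)
  have deg: "card (nbrs E v) \<le> \<Delta>" for v
  proof (cases "v \<in> V")
    case True
    then show ?thesis unfolding assms(3)[symmetric] max_degree_def vd[symmetric] using finV by simp
  next
    case False
    then have "nbrs E v = {}" using graph_edgeD(1)[OF graph] by (auto simp: nbrs_def)
    then show ?thesis by simp
  qed
  have "\<Delta> \<in> insert 0 (vdegree E ` V)"
    unfolding assms(3)[symmetric] max_degree_def using finV by (intro Max_in) auto
  \<comment> \<open>As \<Delta> \<ge> 5, the maximum is not the inserted 0, so a vertex attains
    it.\<close>
  then obtain x where x: "x \<in> V" "card (nbrs E x) = \<Delta>" using assms(4) vd by auto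
  obtain f where f: "inj_on f V" "noncrossing E f"
    using outerplanar_imp_noncrossing[OF assms(1,2)] by blast
  have upper: "inductiveness V (square_edges V E) \<le> k"
    if "pieces_closed s t" "\<Delta> \<le> D" "s \<le> k" "D + t \<le> k" "5 \<le> k" for s t D k
  proof (rule inductiveness_le[OF finV])
    show "V \<noteq> {}" using x(1) by blast
    have "card (nbrs E v) \<le> D" for v using deg[of v] that(2) by simp
    then show "\<exists>v\<in>S. vdegree (induced_edges (square_edges V E) S) v \<le> k" if "S \<subseteq> V" "S \<noteq> {}" for S
      using square_degenerate[OF graph f \<open>pieces_closed s t\<close> _ \<open>s \<le> k\<close> \<open>D + t \<le> k\<close> \<open>5 \<le> k\<close> that]
        vdegree_induced_square[OF graph, of _ S] by fastforce
  qed
  have lower: "\<Delta> \<le> inductiveness V (square_edges V E)"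
  proof (rule inductiveness_ge[OF finV])
    let ?S = "insert x (nbrs E x)"
    show "?S \<subseteq> V" using x(1) nbrs_subset[OF graph, of x] by blast
    show "?S \<noteq> {}" by blast
    fix v assume v: "v \<in> ?S"
    have "?S - {v} \<subseteq> ball2 E v \<inter> ?S"
      using v by (auto simp: ball2_def nbrs_def insert_commute)
    moreover have "finite ?S" using finite_nbrs[OF graph] by simp
    ultimately have "card (?S - {v}) \<le> card (ball2 E v \<inter> ?S)" by (intro card_mono) auto
    moreover have "card (?S - {v}) = \<Delta>"
      using v x(2) finite_nbrs[OF graph, of x] nbrs_subset[OF graph, of x]
      by (subst card_Diff_singleton) (auto simp: card_insert_if)
    ultimately show "\<Delta> \<le> vdegree (induced_edges (square_edges V E) ?S) v"
      using vdegree_induced_square[OF graph v] by simp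
  qed
  consider "\<Delta> = 5" | "\<Delta> = 6" | "\<Delta> \<ge> 7" using assms(4) by linarith
  then show ?thesis
  proof cases
    case 1
    then show ?thesis using upper[OF pieces_closed_6_1, of 5 6] by simp
  next
    case 2
    \<comment> \<open>The degree bound is relaxed to \<open>D = 7\<close>, so that
      \<open>k = 7\<close> is \<Delta> + 1.\<close>
    then show ?thesis using upper[OF pieces_closed_7_0, of 7 7] by simp
  next
    case 3
    then show ?thesis using upper[OF pieces_closed_7_0, of \<Delta> \<Delta>] lower by simp
  qed
qed

end
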